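(* Let $\mathcal{A}$ be an associative $\mathbb{C}$-algebra. Let $A\in\operatorname{Mat}_{M,M}(\mathcal{A})$ and $B\in\operatorname{Mat}_{N,N}(\mathcal{A})$ satisfy: (i) the entries of $A$ anticommute with each other; (ii) the entries of $B$ anticommute with each other; (iii) the entries of $A$ commute with the entries of $B$. (Hence the entries of the Kronecker product $A\otimes B$ commute with each other.) Then \begin{align*} \operatorname{det}_n(A\otimes B) &= \operatorname{per}_n(A\otimes B)\\ &= \sum_{\lambda\in P_{\mathrm{self\text{-}conj}}(n)} (-1)^{m(\lambda)}\operatorname{imm}^{*\lambda}_nA\,\operatorname{imm}^{*\lambda}_nB\\ &= \sum_{(\mu_1,\ldots,\mu_r)\in P_{\mathrm{strict,odd}}(n)} \frac{1}{\mu_1\cdots\mu_r}\operatorname{tr}(A^{\mu_1})\cdots\operatorname{tr}(A^{\mu_r})\operatorname{tr}(B^{\mu_1})\cdots\operatorname{tr}(B^{\mu_r}). \end{align*}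
   Context: Elements of a set $X$ are said to anticommute with each other if $xy=-yx$ for all $x,y\in X$ (in particular, $xx=-xx$ for all $x\in X$). $\operatorname{Mat}_{N,N}(\mathcal{A})$ is the set of $N\times N$ matrices with entries in $\mathcal{A}$, $[N]=\{1,\ldots,N\}$, $i$ is the imaginary unit, and $\operatorname{tr}$ is the sum of the diagonal entries. For $X=(x_{ij})\in\operatorname{Mat}_{N,N}(\mathcal{A})$ and $I=(i_1,\ldots,i_n)\in[N]^n$, put $X_{II}=(x_{i_s i_t})_{1\leq s,t\leq n}$ (repetitions allowed). For an $N\times N$ matrix $X$ put $\operatorname{det}_nX=\frac1{n!}\sum_{I\in[N]^n}\det X_{II}$ and $\operatorname{per}_nX=\frac1{n!}\sum_{I\in[N]^n}\operatorname{per}X_{II}$, where $\det$ and $\operatorname{per}$ are the determinant and permanent. The Kronecker product of $A=(a_{ij})_{1\le i,j\le M}$ and $B=(b_{kl})_{1\le k,l\le N}$ is the $MN\times MN$ matrix $A\otimes B=(a_{ij}b_{kl})_{(i,k),(j,l)\in[M]\times[N]}$; for it the sums in $\det_n$, $\operatorname{per}_n$ run over $([M]\times[N])^n$. $P_{\mathrm{self\text{-}conj}}(n)$ is the set of self-conjugate partitions of $n$; $P_{\mathrm{strict,odd}}(n)$ is the set of partitions $(\mu_1,\ldots,\mu_r)$ of $n$ with $r\geq 0$ and $\mu_1>\cdots>\mu_r>0$ all odd. Partitions of $n$ are considered for all $n\geq 0$; for $n=0$ (empty partition, $r=0$) empty products equal $1$. Definition of $m$ and $\chi^{*\lambda}$.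 Let $\lambda$ be a self-conjugate partition of $n$ (that is, $\lambda=\lambda'$, where $\lambda'$ is the conjugate partition), and let $r$ be its rank (the length of its main diagonal). Put $m(\lambda)=\frac12(n-r)$ (an integer) and $\mu=h(\lambda)=(\mu_1,\ldots,\mu_r)=(2\lambda_1-1,2\lambda_2-3,\ldots,2\lambda_r-(2r-1))$, the sequence of lengths of the diagonal hooks of $\lambda$; it is a partition of $n$ into distinct odd parts. For $\sigma$ in the symmetric group $\mathfrak{S}_n$ of cycle type $\mu$, write $\sigma=(i_{11}\ i_{12}\ \ldots\ i_{1\mu_1})(i_{21}\ \ldots\ i_{2\mu_2})\cdots(i_{r1}\ \ldots\ i_{r\mu_r})$ with cycles ordered by decreasing length, and let $f(\sigma)=1$ (resp. $-1$) if the number of inversions of the sequence $(i_{11},\ldots,i_{1\mu_1},i_{21},\ldots,i_{2\mu_2},\ldots,i_{r1},\ldots,i_{r\mu_r})$ is even (resp. odd); this is well defined since the $\mu_k$ are odd and distinct. Define $\chi^{*\lambda}:\mathfrak{S}_n\to\mathbb{C}$ by $$\chi^{*\lambda}(\sigma)=\begin{cases} f(\sigma)\, i^{m(\lambda)}\sqrt{\mu_1\cdots\mu_r}, & \text{if } \sigma \text{ has cycle type } \mu=h(\lambda),\\ 0,&\text{otherwise.}\end{cases}$$ For an $n\times n$ matrix $X=(x_{ij})$ over $\mathcal{A}$, the twisted immanant is $\operatorname{imm}^{*\lambda}X=\sum_{\sigma\in\mathfrak{S}_n}\chi^{*\lambda}(\sigma)\,x_{1\sigma(1)}\cdots x_{n\sigma(n)}$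 (product in this order). For a square matrix $X\in\operatorname{Mat}_{N,N}(\mathcal{A})$, put $\operatorname{imm}^{*\lambda}_n X=\frac{1}{n!}\sum_{I\in[N]^n}\operatorname{imm}^{*\lambda}X_{II}$. *)

theory Defs
  imports "HOL-Analysis.Analysis" "HOL-Combinatorics.Combinatorics"
begin

section \<open>Complex algebras\<close>

text \<open>Associative, unital, not necessarily commutative: the complex analogue of
  \<^class>\<open>real_algebra_1\<close>.\<close>

class complex_algebra_1 = ring_1 +
  fixes scaleC :: "complex \<Rightarrow> 'a \<Rightarrow> 'a" (infixr \<open>*\<^sub>C\<close> 75)
  assumes scaleC_add_right: "a *\<^sub>C (x + y) = a *\<^sub>C x + a *\<^sub>C y"
    and scaleC_add_left: "(a + b) *\<^sub>C x = a *\<^sub>C x + b *\<^sub>C x"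
    and scaleC_scaleC: "a *\<^sub>C b *\<^sub>C x = (a * b) *\<^sub>C x"
    and scaleC_one: "1 *\<^sub>C x = x"
    and mult_scaleC_left: "a *\<^sub>C x * y = a *\<^sub>C (x * y)"
    and mult_scaleC_right: "x * a *\<^sub>C y = a *\<^sub>C (x * y)"

section \<open>Matrices over a noncommutative algebra\<close>

definition anticommuting :: "'a::ring set \<Rightarrow> bool" where
  "anticommuting X \<longleftrightarrow> (\<forall>x\<in>X. \<forall>y\<in>X. x * y = - (y * x))"

definition entries :: "'a^'n^'m \<Rightarrow> 'a set" where
  "entries X = {X $ i $ j | i j. True}"

definition kronecker :: "'a::times^'m^'m \<Rightarrow> 'a^'n^'n \<Rightarrow> 'a^('m \<times> 'n)^('m \<times> 'n)" where
  "kronecker A B = (\<chi> p q. A $ fst p $ fst q * B $ snd p $ snd q)"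

text \<open>The power with respect to matrix multiplication; \<open>A ^ k\<close> would be entrywise.\<close>

definition matpow :: "'a::semiring_1^'n^'n \<Rightarrow> nat \<Rightarrow> 'a^'n^'n" where
  "matpow A k = (((**) A) ^^ k) (mat 1)"

text \<open>
  An \<open>n \<times> n\<close> matrix whose size \<open>n\<close> is a variable is a function \<open>X\<close> of which only the values
  \<open>X s t\<close> with \<open>s, t < n\<close> matter; rows, columns and the points permuted by the symmetric group
  are numbered from \<open>0\<close>. Likewise \<open>[N]\<^sup>n\<close> is \<open>{..<n} \<rightarrow>\<^sub>E UNIV\<close>.
  All products are taken in row order, \<open>X 0 (\<sigma> 0) \<cdots> X (n - 1) (\<sigma> (n - 1))\<close>. For \<open>det_fun\<close> and
  \<open>per_fun\<close> this matters only if the entries do not commute, which is not the case in the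
  theorem (see \<open>kronecker_entries_commute\<close> below).
\<close>

definition perm_prod :: "nat \<Rightarrow> (nat \<Rightarrow> nat \<Rightarrow> 'a::monoid_mult) \<Rightarrow> (nat \<Rightarrow> nat) \<Rightarrow> 'a" where
  "perm_prod n X \<sigma> = prod_list (map (\<lambda>s. X s (\<sigma> s)) [0..<n])"

definition det_fun :: "nat \<Rightarrow> (nat \<Rightarrow> nat \<Rightarrow> 'a::ring_1) \<Rightarrow> 'a" where
  "det_fun n X = (\<Sum>\<sigma> | \<sigma> permutes {..<n}. of_int (sign \<sigma>) * perm_prod n X \<sigma>)"

definition per_fun :: "nat \<Rightarrow> (nat \<Rightarrow> nat \<Rightarrow> 'a::ring_1) \<Rightarrow> 'a" where
  "per_fun n X = (\<Sum>\<sigma> | \<sigma> permutes {..<n}. perm_prod n X \<sigma>)"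

definition subm :: "'a^'k^'k \<Rightarrow> (nat \<Rightarrow> 'k) \<Rightarrow> nat \<Rightarrow> nat \<Rightarrow> 'a" where
  "subm X I s t = X $ I s $ I t"

definition det_n :: "nat \<Rightarrow> 'a::complex_algebra_1^'k^'k \<Rightarrow> 'a" where
  "det_n n X = (1 / fact n) *\<^sub>C (\<Sum>I \<in> {..<n} \<rightarrow>\<^sub>E UNIV. det_fun n (subm X I))"

definition per_n :: "nat \<Rightarrow> 'a::complex_algebra_1^'k^'k \<Rightarrow> 'a" where
  "per_n n X = (1 / fact n) *\<^sub>C (\<Sum>I \<in> {..<n} \<rightarrow>\<^sub>E UNIV. per_fun n (subm X I))"

section \<open>Partitions\<close>

text \<open>Partitions are weakly decreasing lists of positive parts; part \<open>i\<close> in the usual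
  1-based numbering is \<open>l ! (i - 1)\<close>.\<close>

definition partition_of :: "nat \<Rightarrow> nat list \<Rightarrow> bool" where
  "partition_of n l \<longleftrightarrow> sorted_wrt (\<ge>) l \<and> 0 \<notin> set l \<and> sum_list l = n"

definition conjugate :: "nat list \<Rightarrow> nat list" where
  "conjugate l = map (\<lambda>j. length (filter (\<lambda>p. j < p) l)) [0..<(case l of [] \<Rightarrow> 0 | p # _ \<Rightarrow> p)]"

definition P_self_conj :: "nat \<Rightarrow> nat list set" where
  "P_self_conj n = {l. partition_of n l \<and> conjugate l = l}"

definition P_strict_odd :: "nat \<Rightarrow> nat list set" where
  "P_strict_odd n = {l. partition_of n l \<and> sorted_wrt (>) l \<and> (\<forall>p \<in> set l. odd p)}"

definition diag_rank :: "nat list \<Rightarrow> nat" where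
  "diag_rank l = card {i. i < length l \<and> i < l ! i}"

definition m_half :: "nat list \<Rightarrow> nat" where
  "m_half l = (sum_list l - diag_rank l) div 2"

definition diag_hooks :: "nat list \<Rightarrow> nat list" where
  "diag_hooks l = map (\<lambda>i. 2 * l ! i - (2 * i + 1)) [0..<diag_rank l]"

section \<open>Twisted characters and immanants\<close>

text \<open>\<open>cycle_notation n \<sigma> cs\<close>: \<open>\<sigma>\<close> is a permutation of \<open>{..<n}\<close> and \<open>cs\<close> a way of writing it as a
  product of disjoint cycles, fixed points included, of weakly decreasing length.\<close>

definition cycle_notation :: "nat \<Rightarrow> (nat \<Rightarrow> nat) \<Rightarrow> nat list list \<Rightarrow> bool" where
  "cycle_notation n \<sigma> cs \<longleftrightarrow>
     [] \<notin> set cs \<and> distinct (concat cs) \<and> set (concat cs) = {..<n} \<and>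
     sorted_wrt (\<ge>) (map length cs) \<and> \<sigma> = foldr (\<circ>) (map cycle_of_list cs) id"

definition has_cycle_type :: "nat \<Rightarrow> (nat \<Rightarrow> nat) \<Rightarrow> nat list \<Rightarrow> bool" where
  "has_cycle_type n \<sigma> \<mu> \<longleftrightarrow> (\<exists>cs. cycle_notation n \<sigma> cs \<and> map length cs = \<mu>)"

definition inversion_count :: "nat list \<Rightarrow> nat" where
  "inversion_count xs = card {(i, j). i < j \<and> j < length xs \<and> xs ! i > xs ! j}"

text \<open>If the cycle lengths of \<open>\<sigma>\<close> are odd and distinct, two choices of \<open>cs\<close> differ only by
  rotations of cycles of odd length, which are even permutations, so the sign does not depend
  on the choice. For other \<open>\<sigma>\<close> the value is not used.\<close>

definition cycle_sign :: "nat \<Rightarrow> (nat \<Rightarrow> nat) \<Rightarrow> int" where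
  "cycle_sign n \<sigma> = (-1) ^ inversion_count (concat (SOME cs. cycle_notation n \<sigma> cs))"

definition chi_star :: "nat \<Rightarrow> nat list \<Rightarrow> (nat \<Rightarrow> nat) \<Rightarrow> complex" where
  "chi_star n l \<sigma> =
     (if has_cycle_type n \<sigma> (diag_hooks l)
      then of_int (cycle_sign n \<sigma>) * \<i> ^ m_half l * of_real (sqrt (real (prod_list (diag_hooks l))))
      else 0)"

definition imm_star :: "nat \<Rightarrow> nat list \<Rightarrow> (nat \<Rightarrow> nat \<Rightarrow> 'a::complex_algebra_1) \<Rightarrow> 'a" where
  "imm_star n l X = (\<Sum>\<sigma> | \<sigma> permutes {..<n}. chi_star n l \<sigma> *\<^sub>C perm_prod n X \<sigma>)"

definition imm_star_n :: "nat \<Rightarrow> nat list \<Rightarrow> 'a::complex_algebra_1^'k^'k \<Rightarrow> 'a" where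
  "imm_star_n n l X = (1 / fact n) *\<^sub>C (\<Sum>I \<in> {..<n} \<rightarrow>\<^sub>E UNIV. imm_star n l (subm X I))"

section \<open>Sanity checks\<close>

lemma kronecker_entries_commute:
  fixes A :: "'a::ring^'m^'m" and B :: "'a^'n^'n"
  assumes A: "anticommuting (entries A)" and B: "anticommuting (entries B)"
    and AB: "\<forall>x \<in> entries A. \<forall>y \<in> entries B. x * y = y * x"
    and x: "x \<in> entries (kronecker A B)" and y: "y \<in> entries (kronecker A B)"
  shows "x * y = y * x"
proof -
  obtain a b where a: "a \<in> entries A" "b \<in> entries B" "x = a * b"
    using x by (fastforce simp: entries_def kronecker_def)
  obtain c d where c: "c \<in> entries A" "d \<in> entries B" "y = c * d"
    using y by (fastforce simp: entries_def kronecker_def)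
  have "x * y = a * (b * c) * d" by (simp add: a c mult.assoc)
  also have "\<dots> = (a * c) * (b * d)" using AB a(2) c(1) by (metis mult.assoc)
  also have "\<dots> = (c * a) * (d * b)"
    using A B a c unfolding anticommuting_def by (metis minus_mult_minus)
  also have "\<dots> = c * (a * d) * b" by (simp add: mult.assoc)
  also have "\<dots> = y * x" using AB a(1) c(2) by (metis a(3) c(3) mult.assoc)
  finally show ?thesis .
qed

lemma finite_partitions: "finite {l. partition_of n l}"
proof (rule finite_subset)
  show "{l. partition_of n l} \<subseteq> {l. set l \<subseteq> {..n} \<and> length l \<le> n}"
  proof safe
    fix l assume l: "partition_of n l"
    show "x \<le> n" if "x \<in> set l" for x
      using l that member_le_sum_list[of x l] by (auto simp: partition_of_def)
    have "0 \<notin> set xs \<Longrightarrow> length xs \<le> sum_list xs" for xs :: "nat list"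
      by (induction xs) auto
    with l show "length l \<le> n" by (auto simp: partition_of_def)
  qed
qed (rule finite_lists_length_le, simp)

lemma finite_P_self_conj: "finite (P_self_conj n)"
  unfolding P_self_conj_def by (rule finite_subset[OF _ finite_partitions[of n]]) auto

lemma finite_P_strict_odd: "finite (P_strict_odd n)"
  unfolding P_strict_odd_def by (rule finite_subset[OF _ finite_partitions[of n]]) auto

end

theory Submission
  imports Defs
begin

text \<open>
  Fix \<open>\<sigma>\<close> and sum \<open>x\<^bsub>I 0, I (\<sigma> 0)\<^esub> \<cdots>\<close> over all \<open>I\<close>. Reordering the anticommuting factors along the cycles of
  \<open>\<sigma>\<close> gives the sign of the reordering times the product of the traces \<open>tr(A\<^sup>k)\<close>, \<open>k\<close> running through
  the cycle lengths. Since \<open>tr(A\<^sup>k) = 0\<close> for even \<open>k > 0\<close> and \<open>tr(A\<^sup>k)\<^sup>2 = 0\<close> for odd \<open>k\<close>, only the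
  \<open>\<sigma>\<close> whose cycle lengths are odd and distinct contribute. They are even permutations, so the
  determinant equals the permanent, and in the product of the sums for \<open>A\<close> and \<open>B\<close> the reordering
  signs cancel. There are \<open>n! / (\<mu>\<^sub>1 \<cdots> \<mu>\<^sub>r)\<close> permutations of such a cycle type, and the
  self-conjugate partitions correspond to these types by their diagonal hooks; the twisted
  immanant of \<open>\<lambda>\<close> only sees the cycle type \<open>h(\<lambda>)\<close>.
\<close>

section \<open>Scalar multiplication\<close>

lemma scaleC_zero_left [simp]: "0 *\<^sub>C x = (0::'a::complex_algebra_1)"
  using scaleC_add_left[of 0 0 x] by simp

lemma scaleC_zero_right [simp]: "c *\<^sub>C 0 = (0::'a::complex_algebra_1)"
  using scaleC_add_right[of c 0 "0::'a"] by simp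

lemma scaleC_minus_left: "(- c) *\<^sub>C x = - (c *\<^sub>C x :: 'a::complex_algebra_1)"
  using scaleC_add_left[of "- c" c x] by (simp add: eq_neg_iff_add_eq_0)

lemma scaleC_sum_right: "c *\<^sub>C (\<Sum>i\<in>S. f i) = (\<Sum>i\<in>S. c *\<^sub>C f i :: 'a::complex_algebra_1)"
  by (induction S rule: infinite_finite_induct) (auto simp: scaleC_add_right)

lemma scaleC_sum_left: "(\<Sum>i\<in>S. f i) *\<^sub>C x = (\<Sum>i\<in>S. f i *\<^sub>C x :: 'a::complex_algebra_1)"
  by (induction S rule: infinite_finite_induct) (auto simp: scaleC_add_left)

lemma scaleC_const_sum:
  "(\<Sum>i\<in>S. x) = of_nat (card S) *\<^sub>C (x :: 'a::complex_algebra_1)"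
  using scaleC_sum_left[of "\<lambda>_. 1" S x] by (simp add: scaleC_one)

text \<open>Written as scalars, signs pass through noncommutative products by
  \<open>mult_scaleC_left\<close> and \<open>mult_scaleC_right\<close>.\<close>

lemma minus_one_power_mult_eq_scaleC:
  "(- 1) ^ k * x = (- 1) ^ k *\<^sub>C (x :: 'a::complex_algebra_1)"
  by (cases "even k") (simp_all add: scaleC_one scaleC_minus_left)

text \<open>Every vanishing argument for traces ends in \<open>x = - x\<close>; the scalar
  \<open>1/2\<close> is what turns \<open>x + x = 0\<close> into \<open>x = 0\<close>.\<close>

lemma eq_minus_self_imp_zero:
  fixes x :: "'a::complex_algebra_1"
  assumes "x = - x"
  shows "x = 0"
proof -
  have "x = (1/2) *\<^sub>C x + (1/2) *\<^sub>C x"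
    by (simp flip: scaleC_add_left add: scaleC_one)
  also have "\<dots> = (1/2) *\<^sub>C (x + x)" by (simp add: scaleC_add_right)
  also have "x + x = 0" using assms by (metis add.right_inverse)
  finally show ?thesis by simp
qed

section \<open>Powers and traces of anticommuting matrices\<close>

lemma matpow_0 [simp]: "matpow A 0 = mat 1"
  by (simp add: matpow_def)

lemma matpow_Suc: "matpow A (Suc k) = A ** matpow A k"
  by (simp add: matpow_def)

lemma matpow_Suc_right: "matpow (A :: 'a::ring_1^'n^'n) (Suc k) = matpow A k ** A"
  by (induction k) (simp_all add: matpow_Suc matrix_mul_assoc)

text \<open>Each of the \<open>l\<close> factors in a term of an entry of \<open>matpow A l\<close>
  contributes a sign \<open>(- 1) ^ p\<close> when \<open>x\<close> moves past it. Keeping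
  \<open>x\<close> and \<open>p\<close> abstract allows two uses: \<open>x\<close> an entry of
  \<open>A\<close> with \<open>p = 1\<close>, then \<open>x\<close> an entry of
  \<open>matpow A k\<close> with \<open>p = k\<close>.\<close>

lemma matpow_sign_commute:
  fixes A :: "'a::ring_1^'n^'n"
  assumes "\<And>c d. x * A $ c $ d = (- 1) ^ p * (A $ c $ d * x)"
  shows "x * matpow A l $ c $ d = (- 1) ^ (p * l) * (matpow A l $ c $ d * x)"
proof (induction l arbitrary: c d)
  case 0
  then show ?case by (simp add: mat_def)
next
  case (Suc l)
  have "x * (A $ c $ e * matpow A l $ e $ d) =
        (- 1) ^ (p * Suc l) * (A $ c $ e * matpow A l $ e $ d * x)" for e
  proof -
    have "x * (A $ c $ e * matpow A l $ e $ d) = (- 1) ^ p * (A $ c $ e * (x * matpow A l $ e $ d))"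
      by (simp flip: mult.assoc add: assms)
    also have "\<dots> = (- 1) ^ (p * Suc l) * (A $ c $ e * matpow A l $ e $ d * x)"
      unfolding Suc by (cases "even p"; cases "even l") (simp_all add: mult.assoc)
    finally show ?thesis .
  qed
  then show ?case
    by (simp add: matpow_Suc matrix_matrix_mult_def sum_distrib_left sum_distrib_right)
qed

lemma anticommuting_entries:
  assumes "anticommuting (entries A)"
  shows "A $ a $ b * A $ c $ d = - (A $ c $ d * A $ a $ b)"
proof -
  have "A $ a $ b \<in> entries A" "A $ c $ d \<in> entries A" by (auto simp: entries_def)
  then show ?thesis using assms unfolding anticommuting_def by blast
qed

lemma entry_matpow_commute:
  fixes A :: "'a::ring_1^'n^'n"
  assumes "anticommuting (entries A)"
  shows "A $ a $ b * matpow A l $ c $ d = (- 1) ^ l * (matpow A l $ c $ d * A $ a $ b)"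
proof -
  have "A $ a $ b * matpow A l $ c $ d = (- 1) ^ (1 * l) * (matpow A l $ c $ d * A $ a $ b)"
    by (rule matpow_sign_commute) (simp only: anticommuting_entries[OF assms, of a b] power_one_right
        mult_minus1)
  then show ?thesis by (simp only: mult_1)
qed

lemma matpow_commute:
  fixes A :: "'a::ring_1^'n^'n"
  assumes "anticommuting (entries A)"
  shows "matpow A k $ a $ b * matpow A l $ c $ d
       = (- 1) ^ (k * l) * (matpow A l $ c $ d * matpow A k $ a $ b)"
proof (rule matpow_sign_commute)
  show "matpow A k $ a $ b * A $ c $ d = (- 1) ^ k * (A $ c $ d * matpow A k $ a $ b)" for c d
    unfolding entry_matpow_commute[OF assms, of c d k a b]
    by (cases "even k") simp_all
qed

text \<open>Moving the first factor of a closed product of length \<open>k\<close> to the end passes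
  \<open>k - 1\<close> factors, an odd number of sign changes, while the sum over all closed
  products stays the same.\<close>

lemma trace_matpow_even_eq_0:
  fixes A :: "'a::complex_algebra_1^'n^'n"
  assumes "anticommuting (entries A)" "even k" "k > 0"
  shows "trace (matpow A k) = 0"
proof -
  obtain j where k: "k = Suc j" and j: "odd j"
    using assms(2,3) by (cases k) auto
  have "trace (matpow A k) = (\<Sum>a\<in>UNIV. \<Sum>b\<in>UNIV. A $ a $ b * matpow A j $ b $ a)"
    by (simp add: trace_def k matpow_Suc matrix_matrix_mult_def)
  also have "\<dots> = - (\<Sum>a\<in>UNIV. \<Sum>b\<in>UNIV. matpow A j $ b $ a * A $ a $ b)"
    using j by (simp add: entry_matpow_commute[OF assms(1)] sum_negf)
  also have "(\<Sum>a\<in>UNIV. \<Sum>b\<in>UNIV. matpow A j $ b $ a * A $ a $ b) = trace (matpow A k)"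
    by (subst sum.swap) (simp add: trace_def k matpow_Suc_right matrix_matrix_mult_def)
  finally show ?thesis by (rule eq_minus_self_imp_zero)
qed

text \<open>Entries of \<open>matpow A k\<close> anticommute because \<open>k * k\<close> is odd, so
  exchanging the two summation indices negates the double sum.\<close>

lemma trace_matpow_odd_square_eq_0:
  fixes A :: "'a::complex_algebra_1^'n^'n"
  assumes "anticommuting (entries A)" "odd k"
  shows "trace (matpow A k) * trace (matpow A k) = 0"
proof -
  have "trace (matpow A k) * trace (matpow A k)
      = (\<Sum>a\<in>UNIV. \<Sum>b\<in>UNIV. matpow A k $ a $ a * matpow A k $ b $ b)"
    by (simp add: trace_def sum_product)
  also have "\<dots> = - (\<Sum>a\<in>UNIV. \<Sum>b\<in>UNIV. matpow A k $ b $ b * matpow A k $ a $ a)"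
    using assms(2) by (subst matpow_commute[OF assms(1)]) (simp add: sum_negf)
  also have "\<dots> = - (trace (matpow A k) * trace (matpow A k))"
    by (subst sum.swap) (simp add: trace_def sum_product)
  finally show ?thesis by (rule eq_minus_self_imp_zero)
qed

lemma prod_list_map_eq_0:
  fixes f :: "'b \<Rightarrow> 'a::semiring_1"
  shows "x \<in> set xs \<Longrightarrow> f x = 0 \<Longrightarrow> prod_list (map f xs) = 0"
  by (induction xs) auto

text \<open>Either some part is even and its trace vanishes, or a part is repeated. Equal parts are
  adjacent in a weakly decreasing list, so in the second case the square of an odd trace occurs as a
  subproduct.\<close>

lemma prod_list_trace_matpow_eq_0:
  fixes A :: "'a::complex_algebra_1^'n^'n"
  assumes A: "anticommuting (entries A)"
    and mu: "partition_of n \<mu>" "\<mu> \<notin> P_strict_odd n"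
  shows "prod_list (map (\<lambda>k. trace (matpow A k)) \<mu>) = 0"
proof (cases "\<forall>k\<in>set \<mu>. odd k")
  case False
  then obtain k where "k \<in> set \<mu>" "even k" "k > 0"
    using mu(1) by (auto simp: partition_of_def intro: gr0I)
  then show ?thesis
    by (intro prod_list_map_eq_0[of k]) (simp_all add: trace_matpow_even_eq_0[OF A])
next
  case odd: True
  have "sorted_wrt (\<ge>) \<mu>" "\<not> sorted_wrt (>) \<mu>"
    using mu odd by (auto simp: partition_of_def P_strict_odd_def)
  with odd show ?thesis
  proof (induction \<mu>)
    case (Cons p \<mu>)
    show ?case
    proof (cases "sorted_wrt (>) \<mu>")
      case True
      then obtain q where "q \<in> set \<mu>" "p \<le> q" using Cons.prems by (auto simp: not_less)
      \<comment> \<open>The head of \<open>\<mu>\<close> lies between \<open>q\<close> and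
        \<open>p\<close>, and \<open>p \<le> q\<close> forces all three to be equal.\<close>
      then obtain \<nu> where "\<mu> = p # \<nu>" using Cons.prems by (cases \<mu>) force+
      then show ?thesis
        using trace_matpow_odd_square_eq_0[OF A, of p] Cons.prems by (simp flip: mult.assoc)
    qed (use Cons in simp)
  qed simp
qed

section \<open>Signed reordering\<close>

lemma inversion_count_Nil [simp]: "inversion_count [] = 0"
  by (simp add: inversion_count_def)

text \<open>Inversions are split into those that involve position 0 (\<open>?S\<close>) and those
  shifted up from the tail (\<open>?T\<close>).\<close>

lemma inversion_count_Cons:
  "inversion_count (x # xs) = length (filter (\<lambda>y. y < x) xs) + inversion_count xs"
proof -
  let ?S = "(\<lambda>j. (0::nat, Suc j)) ` {j. j < length xs \<and> xs ! j < x}"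
  let ?T = "map_prod Suc Suc ` {(i, j). i < j \<and> j < length xs \<and> xs ! i > xs ! j}"
  have "{(i, j). i < j \<and> j < length (x # xs) \<and> (x # xs) ! i > (x # xs) ! j} = ?S \<union> ?T" (is "?L = _")
  proof (intro set_eqI, clarify)
    fix i j show "(i, j) \<in> ?L \<longleftrightarrow> (i, j) \<in> ?S \<union> ?T"
      by (cases i; cases j) (auto simp: image_iff)
  qed
  moreover have "finite {(i, j). i < j \<and> j < length xs \<and> xs ! i > xs ! j}"
    by (rule finite_subset[of _ "{..<length xs} \<times> {..<length xs}"]) auto
  then have "card (?S \<union> ?T) = card ?S + card ?T"
    by (intro card_Un_disjoint finite_imageI) auto
  moreover have "card ?S = length (filter (\<lambda>y. y < x) xs)"
    by (simp add: card_image inj_on_def length_filter_conv_card)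
  moreover have "card ?T = inversion_count xs"
    unfolding inversion_count_def by (rule card_image) (auto simp: inj_on_def)
  ultimately show ?thesis by (simp add: inversion_count_def)
qed

text \<open>The new factor moves past exactly the elements smaller than \<open>x\<close>, one sign
  each.\<close>

lemma prod_list_insort_anticommute:
  fixes g :: "nat \<Rightarrow> 'a::ring_1"
  assumes g: "\<And>a b. g a * g b = - (g b * g a)" and "sorted ys"
  shows "prod_list (map g (insort x ys))
       = (- 1) ^ length (filter (\<lambda>y. y < x) ys) * (g x * prod_list (map g ys))"
  using assms(2)
proof (induction ys)
  case (Cons y ys)
  show ?case
  proof (cases "x \<le> y")
    case True
    then have "filter (\<lambda>z. z < x) (y # ys) = []"
      using Cons.prems by (auto simp: filter_empty_conv)
    then show ?thesis using True by simp
  next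
    case False
    have "g y * ((- 1) ^ k * (g x * P)) = (- 1) ^ Suc k * (g x * (g y * P))" for k P
      by (cases "even k") (simp_all flip: mult.assoc add: g[of y x])
    then show ?thesis using False Cons by simp
  qed
qed simp

lemma length_filter_sort: "length (filter P (sort xs)) = length (filter P xs)"
  by (metis mset_filter mset_sort size_mset)

text \<open>Insertion sort undoes each inversion by one exchange of neighbouring factors. It will be
  applied to the word of all cycles of a permutation, whose sorted form is the row order.\<close>

lemma prod_list_sort_anticommute:
  fixes g :: "nat \<Rightarrow> 'a::ring_1"
  assumes g: "\<And>a b. g a * g b = - (g b * g a)"
  shows "prod_list (map g (sort xs)) = (- 1) ^ inversion_count xs * prod_list (map g xs)"
proof (induction xs)
  case (Cons x xs)
  have "g x * ((- 1) ^ k * P) = (- 1) ^ k * (g x * P)" for k P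
    by (cases "even k") simp_all
  then show ?case
    using Cons by (simp add: prod_list_insort_anticommute[OF g] inversion_count_Cons
        length_filter_sort power_add mult.assoc)
qed simp

section \<open>Sums over closed walks\<close>

text \<open>Summed over all lists \<open>L\<close> of length \<open>m\<close>, this becomes an entry
  of \<open>matpow A (Suc m)\<close>; see \<open>sum_walk\<close>.\<close>

fun walk :: "'a::monoid_mult^'k^'k \<Rightarrow> 'k \<Rightarrow> 'k list \<Rightarrow> 'k \<Rightarrow> 'a" where
  "walk A a [] b = A $ a $ b"
| "walk A a (c # L) b = A $ a $ c * walk A c L b"

text \<open>Meant for nonempty \<open>L\<close> only: for the empty list, \<open>hd\<close> is
  unspecified.\<close>

definition closed_walk :: "'a::monoid_mult^'k^'k \<Rightarrow> 'k list \<Rightarrow> 'a" where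
  "closed_walk A L = walk A (hd L) (tl L) (hd L)"

lemma sum_PiE_insert:
  assumes "y \<notin> S"
  shows "(\<Sum>I \<in> insert y S \<rightarrow>\<^sub>E T. f I) = (\<Sum>c\<in>T. \<Sum>I \<in> S \<rightarrow>\<^sub>E T. f (I(y := c)))"
  unfolding PiE_insert_eq sum.cartesian_product
  by (subst sum.reindex[OF inj_combinator[OF assms]]) (simp add: case_prod_unfold)

text \<open>Summing over the value at one intermediate point performs one matrix multiplication.
  \<open>F\<close> stands for the factors of the remaining cycles; it depends only on the values on
  \<open>S\<close>, so it splits off on the right.\<close>

lemma sum_walk:
  fixes A :: "'a::ring_1^'k^'k"
  assumes "distinct ys" "set ys \<inter> S = {}" "\<And>I y c. y \<notin> S \<Longrightarrow> F (I(y := c)) = F I"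
  shows "(\<Sum>I \<in> set ys \<union> S \<rightarrow>\<^sub>E UNIV. walk A a (map I ys) b * F I)
       = matpow A (Suc (length ys)) $ a $ b * (\<Sum>I \<in> S \<rightarrow>\<^sub>E UNIV. F I)"
  using assms(1,2)
proof (induction ys arbitrary: a)
  case Nil
  then show ?case by (simp add: matpow_Suc sum_distrib_left)
next
  case (Cons y ys)
  have upd: "map (I(y := c)) ys = map I ys" for I and c :: 'k using Cons.prems by simp
  have "(\<Sum>I \<in> set (y # ys) \<union> S \<rightarrow>\<^sub>E UNIV. walk A a (map I (y # ys)) b * F I)
      = (\<Sum>c\<in>UNIV. \<Sum>I \<in> set ys \<union> S \<rightarrow>\<^sub>E UNIV. A $ a $ c * (walk A c (map I ys) b * F I))"
    using Cons.prems
    by (simp add: sum_PiE_insert upd assms(3) mult.assoc del: fun_upd_apply)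
       (simp add: fun_upd_same)
  also have "\<dots> = (\<Sum>c\<in>UNIV. A $ a $ c * matpow A (Suc (length ys)) $ c $ b) * (\<Sum>I \<in> S \<rightarrow>\<^sub>E UNIV. F I)"
    using Cons by (simp flip: sum_distrib_left add: sum_distrib_right mult.assoc)
  finally show ?case by (simp add: matpow_Suc[of A "Suc _"] matrix_matrix_mult_def)
qed

lemma sum_closed_walk:
  fixes A :: "'a::ring_1^'k^'k"
  assumes "distinct c" "c \<noteq> []" "set c \<inter> S = {}" "\<And>I y e. y \<notin> S \<Longrightarrow> F (I(y := e)) = F I"
  shows "(\<Sum>I \<in> set c \<union> S \<rightarrow>\<^sub>E UNIV. closed_walk A (map I c) * F I)
       = trace (matpow A (length c)) * (\<Sum>I \<in> S \<rightarrow>\<^sub>E UNIV. F I)"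
proof -
  obtain x ys where c: "c = x # ys" using assms(2) by (cases c) auto
  have upd: "map (I(x := e)) ys = map I ys" for I and e :: 'k using assms(1) by (simp add: c)
  have "(\<Sum>I \<in> set c \<union> S \<rightarrow>\<^sub>E UNIV. closed_walk A (map I c) * F I)
      = (\<Sum>e\<in>UNIV. \<Sum>I \<in> set ys \<union> S \<rightarrow>\<^sub>E UNIV. walk A e (map I ys) e * F I)"
    using assms(1,3) by (simp add: c closed_walk_def sum_PiE_insert upd assms(4) del: fun_upd_apply)
       (simp add: fun_upd_same)
  also have "\<dots> = trace (matpow A (length c)) * (\<Sum>I \<in> S \<rightarrow>\<^sub>E UNIV. F I)"
    using assms(1,3,4) by (simp add: c sum_walk trace_def sum_distrib_right)
  finally show ?thesis .
qed

lemma sum_prod_closed_walks: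
  fixes A :: "'a::ring_1^'k^'k"
  assumes "distinct (concat cs)" "[] \<notin> set cs"
  shows "(\<Sum>I \<in> set (concat cs) \<rightarrow>\<^sub>E UNIV. prod_list (map (\<lambda>c. closed_walk A (map I c)) cs))
       = prod_list (map (\<lambda>c. trace (matpow A (length c))) cs)"
  using assms
proof (induction cs)
  case (Cons c cs)
  have "(\<Sum>I \<in> set c \<union> set (concat cs) \<rightarrow>\<^sub>E UNIV.
          closed_walk A (map I c) * prod_list (map (\<lambda>c. closed_walk A (map I c)) cs))
      = trace (matpow A (length c)) *
        (\<Sum>I \<in> set (concat cs) \<rightarrow>\<^sub>E UNIV. prod_list (map (\<lambda>c. closed_walk A (map I c)) cs))"
  proof (rule sum_closed_walk)
    fix I :: "'b \<Rightarrow> 'k" and y e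
    assume "y \<notin> set (concat cs)"
    then have "map (I(y := e)) c = map I c" if "c \<in> set cs" for c
      using that by auto
    then show "prod_list (map (\<lambda>c. closed_walk A (map (I(y := e)) c)) cs)
             = prod_list (map (\<lambda>c. closed_walk A (map I c)) cs)"
      by (metis (mono_tags, lifting) map_eq_conv)
  qed (use Cons.prems in auto)
  then show ?case using Cons by simp
qed simp

text \<open>The hypothesis says that \<open>\<sigma>\<close> moves each point of the list to the
  next one and the last point to \<open>z\<close>; a cycle is the case \<open>z = x\<close>.\<close>

lemma prod_list_eq_walk:
  assumes "map \<sigma> (x # ys) = ys @ [z]"
  shows "prod_list (map (\<lambda>s. A $ I s $ I (\<sigma> s)) (x # ys)) = walk A (I x) (map I ys) (I z)"
  using assms by (induction ys arbitrary: x) auto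

lemma prod_list_eq_closed_walk:
  assumes "map \<sigma> c = rotate1 c" "c \<noteq> []"
  shows "prod_list (map (\<lambda>s. A $ I s $ I (\<sigma> s)) c) = closed_walk A (map I c)"
  using prod_list_eq_walk[of \<sigma> "hd c" "tl c" "hd c"] assms
  by (cases c) (simp_all add: closed_walk_def)

text \<open>Only factors of different kinds are exchanged; the order within each kind is preserved,
  as is needed for anticommuting entries.\<close>

lemma prod_list_map_mult_commute:
  fixes f g :: "'b \<Rightarrow> 'a::monoid_mult"
  assumes "\<And>x y. f x * g y = g y * f x"
  shows "prod_list (map (\<lambda>x. f x * g x) xs) = prod_list (map f xs) * prod_list (map g xs)"
proof (induction xs)
  case (Cons x xs)
  have "g x * prod_list (map f ys) = prod_list (map f ys) * g x" for ys
  proof (induction ys)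
    case (Cons y ys)
    have "g x * prod_list (map f (y # ys)) = f y * (g x * prod_list (map f ys))"
      by (simp flip: mult.assoc add: assms)
    then show ?case using Cons by (simp add: mult.assoc)
  qed simp
  then have "g x * (prod_list (map f xs) * P) = prod_list (map f xs) * (g x * P)" for P
    by (simp flip: mult.assoc)
  then show ?case using Cons by (simp add: mult.assoc)
qed simp

section \<open>Cycle types\<close>

text \<open>The product in \<open>cycle_notation_def\<close>, with recursion equations suited to
  induction on the list of cycles.\<close>

primrec cycles_comp :: "nat list list \<Rightarrow> nat \<Rightarrow> nat" where
  "cycles_comp [] = id"
| "cycles_comp (c # cs) = cycle_of_list c \<circ> cycles_comp cs"

lemma cycles_comp_eq_foldr: "cycles_comp cs = foldr (\<circ>) (map cycle_of_list cs) id"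
  by (induction cs) (simp_all only: list.map foldr.simps cycles_comp.simps o_apply id_apply)

lemma cycle_notation_iff:
  "cycle_notation n \<sigma> cs \<longleftrightarrow>
     [] \<notin> set cs \<and> distinct (concat cs) \<and> set (concat cs) = {..<n} \<and>
     sorted_wrt (\<ge>) (map length cs) \<and> \<sigma> = cycles_comp cs"
  unfolding cycle_notation_def cycles_comp_eq_foldr ..

lemma map_cycle_of_list: "distinct c \<Longrightarrow> map (cycle_of_list c) c = rotate1 c"
  using cyclic_rotation[of c 1] by simp

lemma cycle_of_list_in_set_iff: "cycle_of_list c x \<in> set c \<longleftrightarrow> x \<in> set c"
  by (rule permutes_in_image[OF cycle_permutes])

lemma cycles_comp_outside: "x \<notin> set (concat cs) \<Longrightarrow> cycles_comp cs x = x"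
  by (induction cs) (auto simp: id_outside_supp)

text \<open>By disjointness, the other cycles fix both \<open>x\<close> and its image under its own
  cycle.\<close>

lemma cycles_comp_inside:
  assumes "distinct (concat cs)" "c \<in> set cs" "x \<in> set c"
  shows "cycles_comp cs x = cycle_of_list c x"
  using assms
proof (induction cs)
  case (Cons d cs)
  show ?case
  proof (cases "x \<in> set d")
    case True
    then have "x \<notin> set (concat cs)" using Cons.prems(1) by auto
    moreover have "c = d" using True Cons.prems by auto
    ultimately show ?thesis using cycles_comp_outside[of x cs] by simp
  next
    case False
    then have c: "c \<in> set cs" using Cons.prems by auto
    then have "cycle_of_list c x \<in> set (concat cs)"
      using Cons.prems(3) cycle_of_list_in_set_iff[of c x] by auto
    then have "cycle_of_list c x \<notin> set d" using Cons.prems(1) by auto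
    then show ?thesis using Cons c by (simp add: id_outside_supp)
  qed
qed simp

lemma cycles_comp_cong_set:
  assumes "distinct (concat cs)" "distinct (concat ds)" "set cs = set ds"
  shows "cycles_comp cs = cycles_comp ds"
proof
  fix x
  show "cycles_comp cs x = cycles_comp ds x"
  proof (cases "x \<in> set (concat cs)")
    case True
    then obtain c where "c \<in> set cs" "x \<in> set c" by auto
    then show ?thesis using assms by (simp add: cycles_comp_inside)
  next
    case False
    then have "x \<notin> set (concat ds)" using assms(3) by simp
    with False show ?thesis using cycles_comp_outside[of x cs] cycles_comp_outside[of x ds] by simp
  qed
qed

lemma cycles_comp_permutes: "cycles_comp cs permutes set (concat cs)"
proof (induction cs)
  case (Cons c cs)
  have "cycle_of_list c permutes set (concat (c # cs))"
    by (rule permutes_subset[OF cycle_permutes]) simp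
  moreover have "cycles_comp cs permutes set (concat (c # cs))"
    by (rule permutes_subset[OF Cons]) simp
  ultimately show ?case unfolding cycles_comp.simps by (rule permutes_compose[rotated])
qed (simp only: cycles_comp.simps permutes_id)

lemma cycle_notation_permutes: "cycle_notation n \<sigma> cs \<Longrightarrow> \<sigma> permutes {..<n}"
  using cycles_comp_permutes[of cs] by (simp add: cycle_notation_iff)

section \<open>Existence of cycle notations\<close>

lemma cycle_decomp_cycles_comp:
  "cycle_decomp S p \<Longrightarrow>
    \<exists>cs. [] \<notin> set cs \<and> distinct (concat cs) \<and> set (concat cs) = S \<and> p = cycles_comp cs"
proof (induction rule: cycle_decomp.induct)
  case empty
  show ?case by (rule exI[of _ "[]"]) simp
next
  case (comp I p c)
  then obtain cs where "[] \<notin> set cs" "distinct (concat cs)" "set (concat cs) = I" "p = cycles_comp cs"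
    by blast
  note cs = this
  show ?case
  proof (cases "c = []")
    \<comment> \<open>\<open>cycle_decomp\<close> admits empty cycles; they act as the identity and
      are dropped.\<close>
    case True
    then have "cycle_of_list c \<circ> p = p" by (simp only: cycle_of_list.simps id_comp)
    then show ?thesis using True cs by (intro exI[of _ cs]) simp
  next
    case False
    have "cycle_of_list c \<circ> p = cycles_comp (c # cs)" by (simp only: cycles_comp.simps cs(4))
    moreover have "distinct (concat (c # cs))"
      using comp.hyps cs by simp
    ultimately show ?thesis using False cs by (intro exI[of _ "c # cs"]) simp
  qed
qed

lemma ex_cycle_notation:
  assumes "\<sigma> permutes {..<n}"
  shows "\<exists>cs. cycle_notation n \<sigma> cs"
proof -
  obtain cs where cs: "[] \<notin> set cs" "distinct (concat cs)" "set (concat cs) = {..<n}" "\<sigma> = cycles_comp cs"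
    using cycle_decomp_cycles_comp[OF cycle_decomposition[OF assms]] by auto
  define ds where "ds = rev (sort_key length cs)"
  have set: "set ds = set cs" and mset: "mset ds = mset cs" by (simp_all add: ds_def)
  have "distinct (removeAll [] cs)" using cs(2) unfolding distinct_concat_iff by blast
  then have "distinct ds"
    using cs(1) mset by (metis mset_eq_imp_distinct_iff removeAll_id)
  then have dist: "distinct (concat ds)"
    using cs(2) set unfolding distinct_concat_iff by (simp add: distinct_removeAll)
  have "sorted_wrt (\<ge>) (map length ds)"
    by (simp add: ds_def sorted_wrt_rev flip: rev_map)
  then have "cycle_notation n \<sigma> ds"
    using cs set dist cycles_comp_cong_set[of cs ds] by (simp add: cycle_notation_iff)
  then show ?thesis by blast
qed

lemma cycle_notation_map:
  assumes "cycle_notation n \<sigma> cs" "c \<in> set cs"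
  shows "map \<sigma> c = rotate1 c"
proof -
  have "distinct (concat cs)" and \<sigma>: "\<sigma> = cycles_comp cs"
    using assms by (simp_all add: cycle_notation_iff)
  then have "distinct c" and "\<And>x. x \<in> set c \<Longrightarrow> \<sigma> x = cycle_of_list c x"
    using assms(2) cycles_comp_inside by (auto simp: distinct_concat_iff)
  then show ?thesis using map_cycle_of_list[of c] by (metis map_cong)
qed

section \<open>Cycles as orbits and uniqueness of the cycle lengths\<close>

lemma cycle_notation_funpow:
  assumes "cycle_notation n \<sigma> cs" "c \<in> set cs" "i < length c"
  shows "(\<sigma> ^^ k) (c ! i) = c ! ((i + k) mod length c)"
proof (induction k)
  case 0
  then show ?case using assms(3) by simp
next
  case (Suc k)
  let ?j = "(i + k) mod length c"
  have "c \<noteq> []" using assms(3) by auto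
  then have "?j < length c" by simp
  then have "\<sigma> (c ! ?j) = rotate1 c ! ?j"
    by (simp flip: cycle_notation_map[OF assms(1,2)])
  also have "\<dots> = c ! (Suc ?j mod length c)"
    using \<open>?j < length c\<close> by (simp add: nth_rotate1)
  finally show ?case using Suc by (simp add: mod_Suc_eq)
qed

text \<open>Iterating \<open>\<sigma>\<close> runs around the cycle, so its support is an orbit and
  thus independent of the notation chosen.\<close>

lemma cycle_notation_set_cycle:
  assumes "cycle_notation n \<sigma> cs" "c \<in> set cs" "x \<in> set c"
  shows "set c = range (\<lambda>k. (\<sigma> ^^ k) x)"
proof -
  obtain i where i: "i < length c" "x = c ! i" using assms(3) by (auto simp: in_set_conv_nth)
  note pow = cycle_notation_funpow[OF assms(1,2) i(1), folded i(2)]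
  show ?thesis
  proof
    show "set c \<subseteq> range (\<lambda>k. (\<sigma> ^^ k) x)"
    proof
      fix y assume "y \<in> set c"
      then obtain j where j: "j < length c" "y = c ! j" by (auto simp: in_set_conv_nth)
      \<comment> \<open>This exponent completes the turn from position \<open>i\<close> to the start
        and then goes on to \<open>j\<close>, so the cases \<open>i \<le> j\<close> and
        \<open>j < i\<close> need no separation.\<close>
      have "(\<sigma> ^^ (length c - i + j)) x = c ! j"
        using i(1) j(1) by (simp add: pow)
      then show "y \<in> range (\<lambda>k. (\<sigma> ^^ k) x)" using j(2) by (metis rangeI)
    qed
    show "range (\<lambda>k. (\<sigma> ^^ k) x) \<subseteq> set c"
    proof (rule image_subsetI)
      have "c \<noteq> []" using i(1) by auto
      then show "(\<sigma> ^^ k) x \<in> set c" for k by (simp add: pow)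
    qed
  qed
qed

text \<open>The right-hand side is the multiset of orbit sizes, which mentions only
  \<open>\<sigma>\<close>. Distinct cycles are nonempty and disjoint, so they have distinct supports
  and no multiplicity is lost.\<close>

lemma cycle_notation_mset_lengths:
  assumes "cycle_notation n \<sigma> cs"
  shows "mset (map length cs)
       = image_mset card (mset_set ((\<lambda>x. range (\<lambda>k. (\<sigma> ^^ k) x)) ` {..<n}))"
proof -
  have cs: "[] \<notin> set cs" "distinct (concat cs)" "set (concat cs) = {..<n}"
    using assms by (simp_all add: cycle_notation_iff)
  have dist: "distinct cs" and disj: "\<And>c d. c \<in> set cs \<Longrightarrow> d \<in> set cs \<Longrightarrow> c \<noteq> d \<Longrightarrow> set c \<inter> set d = {}"
    and dist': "\<And>c. c \<in> set cs \<Longrightarrow> distinct c"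
    using cs(1,2) by (auto simp: distinct_concat_iff removeAll_id)
  have inj: "inj_on set (set cs)"
  proof (rule inj_onI)
    fix c d assume "c \<in> set cs" "d \<in> set cs" "set c = set d"
    then show "c = d" using disj[of c d] cs(1) by (cases c) auto
  qed
  have "(\<lambda>x. range (\<lambda>k. (\<sigma> ^^ k) x)) ` {..<n} = set ` set cs"
  proof
    show "(\<lambda>x. range (\<lambda>k. (\<sigma> ^^ k) x)) ` {..<n} \<subseteq> set ` set cs"
    proof (rule image_subsetI)
      fix x assume "x \<in> {..<n}"
      then obtain c where "c \<in> set cs" "x \<in> set c" using cs(3) by auto
      then show "range (\<lambda>k. (\<sigma> ^^ k) x) \<in> set ` set cs"
        using cycle_notation_set_cycle[OF assms] by auto
    qed
    show "set ` set cs \<subseteq> (\<lambda>x. range (\<lambda>k. (\<sigma> ^^ k) x)) ` {..<n}"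
    proof (rule image_subsetI)
      fix c assume c: "c \<in> set cs"
      then have "c \<noteq> []" using cs(1) by auto
      then have "hd c \<in> set c" by simp
      moreover have "hd c \<in> {..<n}" using calculation c cs(3) by auto
      ultimately show "set c \<in> (\<lambda>x. range (\<lambda>k. (\<sigma> ^^ k) x)) ` {..<n}"
        using cycle_notation_set_cycle[OF assms c, of "hd c"] by blast
    qed
  qed
  then have "mset_set ((\<lambda>x. range (\<lambda>k. (\<sigma> ^^ k) x)) ` {..<n}) = image_mset set (mset cs)"
    using image_mset_mset_set[OF inj] dist by (simp add: mset_set_set)
  moreover have "map length cs = map (card \<circ> set) cs"
    using dist' by (simp add: distinct_card)
  ultimately show ?thesis by (simp only: mset_map multiset.map_comp)
qed

lemma cycle_notation_lengths_unique:
  assumes "cycle_notation n \<sigma> cs" "cycle_notation n \<sigma> ds"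
  shows "map length cs = map length ds"
proof -
  have "sorted (rev (map length cs))" "sorted (rev (map length ds))"
    using assms by (simp_all add: cycle_notation_iff sorted_wrt_rev)
  moreover have "mset (rev (map length cs)) = mset (rev (map length ds))"
    using assms[THEN cycle_notation_mset_lengths] by simp
  ultimately have "rev (map length cs) = rev (map length ds)"
    by (metis properties_for_sort)
  then show ?thesis by simp
qed

text \<open>The same choice as in \<open>cycle_sign_def\<close>, so that the cycle type and the sign
  refer to one and the same notation.\<close>

definition some_cycles :: "nat \<Rightarrow> (nat \<Rightarrow> nat) \<Rightarrow> nat list list" where
  "some_cycles n \<sigma> = (SOME cs. cycle_notation n \<sigma> cs)"

definition cycle_type :: "nat \<Rightarrow> (nat \<Rightarrow> nat) \<Rightarrow> nat list" where
  "cycle_type n \<sigma> = map length (some_cycles n \<sigma>)"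

lemma some_cycles: "\<sigma> permutes {..<n} \<Longrightarrow> cycle_notation n \<sigma> (some_cycles n \<sigma>)"
  unfolding some_cycles_def by (rule someI_ex[OF ex_cycle_notation])

lemma has_cycle_type_iff:
  assumes "\<sigma> permutes {..<n}"
  shows "has_cycle_type n \<sigma> \<mu> \<longleftrightarrow> cycle_type n \<sigma> = \<mu>"
  unfolding has_cycle_type_def cycle_type_def
  using some_cycles[OF assms] cycle_notation_lengths_unique[OF some_cycles[OF assms]] by blast

lemma partition_of_cycle_type:
  assumes "\<sigma> permutes {..<n}"
  shows "partition_of n (cycle_type n \<sigma>)"
proof -
  let ?cs = "some_cycles n \<sigma>"
  have cs: "cycle_notation n \<sigma> ?cs" by (rule some_cycles[OF assms])
  then have "length (concat ?cs) = n"
    unfolding cycle_notation_iff by (metis card_lessThan distinct_card)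
  then show ?thesis
    using cs by (auto simp: partition_of_def cycle_type_def cycle_notation_iff length_concat)
qed

section \<open>Signs of permutations with odd cycle lengths\<close>

lemma sign_cycle_of_list:
  assumes "distinct c" "c \<noteq> []"
  shows "sign (cycle_of_list c) = (- 1) ^ (length c - 1)"
  using assms
proof (induction c rule: cycle_of_list.induct)
  case (1 i j cs)
  then show ?case
    by (simp add: sign_compose permutation_swap_id permutation_of_cycle sign_swap_id del: o_apply)
qed (auto simp: sign_id)

lemma permutation_cycles_comp: "permutation (cycles_comp cs)"
  by (induction cs) (simp_all add: permutation_compose permutation_of_cycle flip: id_def del: comp_apply)

lemma sign_cycles_comp_odd:
  assumes "distinct (concat cs)" "\<forall>c\<in>set cs. odd (length c)"
  shows "sign (cycles_comp cs) = 1"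
  using assms
proof (induction cs)
  case (Cons c cs)
  then have "c \<noteq> []" by auto
  moreover have "sign (cycles_comp (c # cs)) = sign (cycle_of_list c) * sign (cycles_comp cs)"
    unfolding cycles_comp.simps
    by (rule sign_compose[OF permutation_of_cycle permutation_cycles_comp])
  moreover have "sign (cycles_comp cs) = 1" "distinct c" "odd (length c)" using Cons by simp_all
  moreover have "sign (cycle_of_list c) = 1" using calculation by (simp add: sign_cycle_of_list)
  ultimately show ?case by (simp only: mult_1)
qed (simp only: cycles_comp.simps sign_id)

lemma sign_eq_1_of_cycle_type:
  assumes "\<sigma> permutes {..<n}" "cycle_type n \<sigma> \<in> P_strict_odd n"
  shows "sign \<sigma> = 1"
  using some_cycles[OF assms(1)] assms(2) sign_cycles_comp_odd[of "some_cycles n \<sigma>"]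
  by (auto simp: cycle_notation_iff cycle_type_def P_strict_odd_def)

section \<open>Counting the permutations of a given cycle type\<close>

definition rotations :: "'b list \<Rightarrow> 'b list set" where
  "rotations c = (\<lambda>k. rotate k c) ` {..<length c}"

text \<open>Rotations of a list with distinct entries are told apart by their first entries.\<close>

lemma card_rotations:
  assumes "distinct c"
  shows "card (rotations c) = length c"
proof -
  have "inj_on (\<lambda>k. rotate k c) {..<length c}"
  proof (rule inj_onI)
    fix k k' assume k: "k \<in> {..<length c}" "k' \<in> {..<length c}" "rotate k c = rotate k' c"
    then have "c \<noteq> []" by auto
    then have "c ! k = c ! k'"
      using k nth_rotate[of 0 c k] nth_rotate[of 0 c k'] by simp
    then show "k = k'" using assms k by (simp add: nth_eq_iff_index_eq)
  qed
  then show ?thesis by (simp add: rotations_def card_image)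
qed

lemma card_listset: "card (listset As) = prod_list (map card As)"
proof (induction As)
  case (Cons B As)
  have "listset (B # As) = (\<lambda>(a, as). a # as) ` (B \<times> listset As)"
    by (auto simp: set_Cons_def)
  moreover have "inj_on (\<lambda>(a, as). a # as) (B \<times> listset As)"
    by (auto simp: inj_on_def)
  ultimately show ?case using Cons by (simp add: card_image card_cartesian_product)
qed simp

lemma listset_map_iff: "cs \<in> listset (map R ds) \<longleftrightarrow> list_all2 (\<lambda>d c. c \<in> R d) ds cs"
proof (induction ds arbitrary: cs)
  case (Cons d ds)
  then show ?case by (cases cs) (auto simp: set_Cons_def)
qed simp

lemma list_all2_rotations:
  assumes "list_all2 (\<lambda>d c. c \<in> rotations d) ds cs" "\<forall>d\<in>set ds. distinct d"
  shows "map length cs = map length ds \<and> map set cs = map set ds \<and>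
    map cycle_of_list cs = map cycle_of_list ds"
  using assms
proof (induction rule: list_all2_induct)
  case (Cons d ds c cs)
  then obtain k where "c = rotate k d" by (auto simp: rotations_def)
  then show ?case using Cons cycle_of_list_rotate_independent[of d k] by simp
qed simp

text \<open>The lengths being distinct, the cycle of a given length is determined up to its starting point.\<close>

lemma cycle_notations_eq_listset:
  assumes ds: "cycle_notation n \<sigma> ds" and strict: "sorted_wrt (>) (map length ds)"
  shows "{cs. cycle_notation n \<sigma> cs} = listset (map rotations ds)"
proof (intro set_eqI iffI)
  fix cs assume "cs \<in> listset (map rotations ds)"
  then have all2: "list_all2 (\<lambda>d c. c \<in> rotations d) ds cs"
    by (simp add: listset_map_iff)
  have ds': "[] \<notin> set ds" "distinct (concat ds)" "set (concat ds) = {..<n}"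
    using ds by (simp_all add: cycle_notation_iff)
  have eq: "map length cs = map length ds" "map set cs = map set ds"
    "map cycle_of_list cs = map cycle_of_list ds"
    using list_all2_rotations[OF all2] ds'(2) by (simp_all add: distinct_concat_iff)
  have "length (concat cs) = length (concat ds)" by (simp add: length_concat eq)
  moreover have set: "set (concat cs) = set (concat ds)"
    using eq(2) by (metis set_concat set_map)
  ultimately have "distinct (concat cs)"
    using ds'(2) by (metis card_distinct distinct_card)
  moreover have "[] \<notin> set cs"
  proof
    assume "[] \<in> set cs"
    then have "0 \<in> set (map length cs)" by force
    then show False using ds'(1) unfolding eq by auto
  qed
  moreover have "cycles_comp cs = cycles_comp ds"
    by (simp only: cycles_comp_eq_foldr eq)
  ultimately show "cs \<in> {cs. cycle_notation n \<sigma> cs}"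
    using ds set eq(1) by (simp add: cycle_notation_iff)
next
  fix cs assume "cs \<in> {cs. cycle_notation n \<sigma> cs}"
  then have cs: "cycle_notation n \<sigma> cs" by simp
  have len: "map length cs = map length ds"
    using cycle_notation_lengths_unique[OF cs ds] .
  then have len': "length cs = length ds" by (metis length_map)
  have "cs ! i \<in> rotations (ds ! i)" if i: "i < length ds" for i
  proof -
    let ?c = "cs ! i" and ?d = "ds ! i"
    have c: "?c \<in> set cs" and d: "?d \<in> set ds" using i len' by simp_all
    have leni: "length (cs ! k) = length (ds ! k)" if "k < length ds" for k
      using that len len' by (metis nth_map)
    have "?c \<noteq> []" using c cs by (auto simp: cycle_notation_iff)
    then have x: "?c ! 0 \<in> set ?c" by simp
    then have "?c ! 0 \<in> set (concat ds)" using c cs ds by (auto simp: cycle_notation_iff)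
    then obtain d where "d \<in> set ds" "?c ! 0 \<in> set d" by auto
    then obtain j where j: "j < length ds" "?c ! 0 \<in> set (ds ! j)"
      by (metis in_set_conv_nth)
    have "set ?c = set (ds ! j)"
      using cycle_notation_set_cycle[OF cs c x] cycle_notation_set_cycle[OF ds _ j(2)] j(1) by simp
    moreover have "distinct ?c" "distinct (ds ! j)"
      using c cs ds j(1) by (simp_all add: cycle_notation_iff distinct_concat_iff)
    ultimately have "length ?c = length (ds ! j)" by (metis distinct_card)
    then have "length ?d = length (ds ! j)" using leni[OF i] by simp
    \<comment> \<open>Strictly decreasing lengths differ at different positions, so the cycle of
      \<open>ds\<close> that meets \<open>?c\<close> is \<open>?d\<close>.\<close>
    then have "j = i"
      using strict i j(1) unfolding sorted_wrt_iff_nth_less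
      by (metis length_map less_irrefl linorder_neqE_nat nth_map)
    then obtain k where k: "k < length ?d" "?c ! 0 = ?d ! k"
      using j(2) by (auto simp: in_set_conv_nth)
    have "?c = rotate k ?d"
    proof (rule nth_equalityI)
      show "length ?c = length (rotate k ?d)" using leni[OF i] by simp
      fix m assume m: "m < length ?c"
      have "?c ! m = (\<sigma> ^^ m) (?c ! 0)"
        using cycle_notation_funpow[OF cs c, of 0 m] m \<open>?c \<noteq> []\<close> by simp
      also have "\<dots> = ?d ! ((k + m) mod length ?d)"
        using cycle_notation_funpow[OF ds d k(1), of m] k(2) by simp
      also have "\<dots> = rotate k ?d ! m"
        using m leni[OF i] by (simp add: nth_rotate add.commute)
      finally show "?c ! m = rotate k ?d ! m" .
    qed
    then show ?thesis using k(1) by (auto simp: rotations_def)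
  qed
  then show "cs \<in> listset (map rotations ds)"
    using len' by (simp add: listset_map_iff list_all2_conv_all_nth)
qed

text \<open>Existence of the cutting of a word into blocks of prescribed lengths;
  \<open>concat_eq_of_lengths\<close> is its uniqueness.\<close>

lemma ex_concat_lengths: "length xs = sum_list \<mu> \<Longrightarrow> \<exists>cs. map length cs = \<mu> \<and> concat cs = xs"
proof (induction \<mu> arbitrary: xs)
  case (Cons k \<mu>)
  obtain cs where "map length cs = \<mu>" "concat cs = drop k xs"
    using Cons.IH[of "drop k xs"] Cons.prems by auto
  then show ?case using Cons.prems by (intro exI[of _ "take k xs # cs"]) simp
qed simp

lemma concat_eq_of_lengths:
  "map length cs = map length ds \<Longrightarrow> concat cs = concat ds \<Longrightarrow> cs = ds"
proof (induction cs arbitrary: ds)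
  case (Cons c cs)
  then show ?case by (cases ds) auto
qed simp

text \<open>Cutting the \<open>n!\<close> orderings of \<open>{..<n}\<close> into blocks of lengths \<open>\<mu>\<close> yields all cycle notations
  of the permutations of cycle type \<open>\<mu>\<close>, and each of them has \<open>\<mu>\<^sub>1 \<cdots> \<mu>\<^sub>r\<close> notations.\<close>

lemma card_cycle_type:
  assumes mu: "\<mu> \<in> P_strict_odd n"
  shows "card {\<sigma>. \<sigma> permutes {..<n} \<and> cycle_type n \<sigma> = \<mu>} * prod_list \<mu> = fact n"
proof -
  have part: "sum_list \<mu> = n" "0 \<notin> set \<mu>" "sorted_wrt (\<ge>) \<mu>" "sorted_wrt (>) \<mu>"
    using mu by (simp_all add: P_strict_odd_def partition_of_def)
  let ?S = "{\<sigma>. \<sigma> permutes {..<n} \<and> cycle_type n \<sigma> = \<mu>}"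
  let ?N = "\<lambda>\<sigma>. {cs. cycle_notation n \<sigma> cs}"
  let ?Y = "{cs. map length cs = \<mu> \<and> distinct (concat cs) \<and> set (concat cs) = {..<n}}"
  have fin: "finite ?S"
    by (rule finite_subset[OF _ finite_permutations[of "{..<n}"]]) auto
  have len: "map length cs = \<mu>" if "\<sigma> \<in> ?S" "cs \<in> ?N \<sigma>" for \<sigma> cs
    using that cycle_notation_lengths_unique[OF _ some_cycles] by (auto simp: cycle_type_def)
  have cardN: "card (?N \<sigma>) = prod_list \<mu>" if s: "\<sigma> \<in> ?S" for \<sigma>
  proof -
    let ?ds = "some_cycles n \<sigma>"
    have ds: "cycle_notation n \<sigma> ?ds" "map length ?ds = \<mu>"
      using s some_cycles by (auto simp: cycle_type_def)
    have "card (?N \<sigma>) = prod_list (map (card \<circ> rotations) ?ds)"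
      using cycle_notations_eq_listset[OF ds(1)] part(4) by (simp add: ds(2) card_listset)
    also have "map (card \<circ> rotations) ?ds = map length ?ds"
      using ds(1) by (auto simp: cycle_notation_iff distinct_concat_iff card_rotations)
    finally show ?thesis by (simp add: ds(2))
  qed
  \<comment> \<open>Infinite sets have cardinality 0, so the nonzero cardinality implies
    finiteness.\<close>
  have "prod_list \<mu> \<noteq> 0" using part(2) by (simp add: prod_list_zero_iff)
  then have finN: "finite (?N \<sigma>)" if "\<sigma> \<in> ?S" for \<sigma>
    using cardN[OF that] by (metis card.infinite)
  have disj: "?N \<sigma> \<inter> ?N \<tau> = {}" if "\<sigma> \<noteq> \<tau>" for \<sigma> \<tau>
    using that by (auto simp: cycle_notation_iff)
  have Y: "?Y = (\<Union>\<sigma>\<in>?S. ?N \<sigma>)"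
  proof (intro set_eqI iffI)
    fix cs assume cs: "cs \<in> ?Y"
    have "[] \<notin> set cs" using cs part(2) by force
    then have not: "cycle_notation n (cycles_comp cs) cs"
      using cs part(3) by (simp add: cycle_notation_iff)
    moreover have "cycles_comp cs permutes {..<n}"
      by (rule cycle_notation_permutes[OF not])
    moreover have "cycle_type n (cycles_comp cs) = \<mu>"
      using cycle_notation_lengths_unique[OF some_cycles not] calculation cs
      by (simp add: cycle_type_def)
    ultimately show "cs \<in> (\<Union>\<sigma>\<in>?S. ?N \<sigma>)" by blast
  next
    fix cs assume "cs \<in> (\<Union>\<sigma>\<in>?S. ?N \<sigma>)"
    then obtain \<sigma> where s: "\<sigma> \<in> ?S" "cs \<in> ?N \<sigma>" by blast
    then show "cs \<in> ?Y" using len[OF s] by (simp add: cycle_notation_iff)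
  qed
  have "card ?S * prod_list \<mu> = (\<Sum>\<sigma>\<in>?S. card (?N \<sigma>))"
    using cardN by simp
  also have "\<dots> = card ?Y"
    unfolding Y using fin finN disj by (intro card_UN_disjoint[symmetric]) auto
  also have "\<dots> = card (concat ` ?Y)"
    by (intro card_image[symmetric] inj_onI) (auto intro: concat_eq_of_lengths)
  also have "concat ` ?Y = permutations_of_set {..<n}"
  proof
    show "concat ` ?Y \<subseteq> permutations_of_set {..<n}"
      by (auto simp: permutations_of_set_def)
    show "permutations_of_set {..<n} \<subseteq> concat ` ?Y"
    proof
      fix xs assume xs: "xs \<in> permutations_of_set {..<n}"
      then have "length xs = sum_list \<mu>"
        using part(1) by (simp add: length_finite_permutations_of_set)
      then obtain cs where cs: "map length cs = \<mu>" "concat cs = xs"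
        using ex_concat_lengths by blast
      have "cs \<in> ?Y" using xs by (simp only: mem_Collect_eq cs permutations_of_set_def)
      then show "xs \<in> concat ` ?Y" unfolding cs(2)[symmetric] by (rule imageI)
    qed
  qed
  finally show ?thesis by simp
qed

section \<open>Self-conjugate partitions and their diagonal hooks\<close>

text \<open>Extending by 0 lets \<open>j < row_len l i\<close> express, for all \<open>i\<close> and
  \<open>j\<close>, that the cell \<open>(i, j)\<close> belongs to the diagram.\<close>

definition row_len :: "nat list \<Rightarrow> nat \<Rightarrow> nat" where
  "row_len l i = (if i < length l then l ! i else 0)"

lemma nat_eqI_less:
  fixes a b :: nat
  assumes "\<And>i. i < a \<longleftrightarrow> i < b"
  shows "a = b"
  using assms[of a] assms[of b] by auto

text \<open>Such a set is an initial segment. This turns the cardinalities that define column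
  lengths and the rank into membership conditions on cells.\<close>

lemma nat_down_closed_less_card:
  fixes S :: "nat set"
  assumes "finite S" and "\<And>i j. i \<le> j \<Longrightarrow> j \<in> S \<Longrightarrow> i \<in> S"
  shows "i < card S \<longleftrightarrow> i \<in> S"
proof -
  have "S = {..<card S}"
  proof (cases "S = {}")
    case False
    have "S = {..Max S}"
      using assms Max_ge Max_in[OF assms(1) False] by auto
    then show ?thesis by (metis card_atMost lessThan_Suc_atMost)
  qed simp
  then show ?thesis by (metis lessThan_iff)
qed

lemma partition_of_row_len_antimono:
  assumes "partition_of n l" "i \<le> j"
  shows "row_len l j \<le> row_len l i"
  using assms unfolding partition_of_def row_len_def sorted_wrt_iff_nth_less
  by (cases "i = j") auto

lemma partition_of_row_len_pos_iff:
  assumes "partition_of n l"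
  shows "0 < row_len l i \<longleftrightarrow> i < length l"
  using assms unfolding partition_of_def row_len_def by (metis gr0I nth_mem less_irrefl)

lemma row_len_eqI:
  assumes l: "partition_of n l" "partition_of n' l'"
    and eq: "\<And>i j. j < row_len l i \<longleftrightarrow> j < row_len l' i"
  shows "l = l'"
proof (rule nth_equalityI)
  have p: "row_len l i = row_len l' i" for i
    using eq by (intro nat_eqI_less)
  then have "i < length l \<longleftrightarrow> i < length l'" for i
    using partition_of_row_len_pos_iff l by metis
  then show len: "length l = length l'" by (intro nat_eqI_less)
  show "l ! i = l' ! i" if "i < length l" for i
    using that p[of i] len by (simp add: row_len_def)
qed

lemma finite_row_len_greater: "finite {i. j < row_len l i}"
  by (rule finite_subset[of _ "{..<length l}"]) (auto simp: row_len_def split: if_splits)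

lemma row_len_conjugate:
  assumes l: "partition_of n l"
  shows "row_len (conjugate l) j = card {i. j < row_len l i}"
proof -
  have eq: "{i. i < length l \<and> j < l ! i} = {i. j < row_len l i}"
    by (auto simp: row_len_def)
  have len: "length (conjugate l) = row_len l 0"
    by (simp add: conjugate_def row_len_def split: list.split)
  show ?thesis
  proof (cases "j < row_len l 0")
    case True
    then show ?thesis
      using eq len unfolding row_len_def[of "conjugate l"]
      by (auto simp: conjugate_def length_filter_conv_card row_len_def nth_append split: list.splits)
  next
    case False
    have "\<not> j < row_len l i" for i
      using False partition_of_row_len_antimono[OF l, of 0 i] by simp
    then show ?thesis using False len by (simp add: row_len_def[of "conjugate l"])
  qed
qed

lemma less_row_len_conjugate:
  assumes l: "partition_of n l"
  shows "i < row_len (conjugate l) j \<longleftrightarrow> j < row_len l i"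
proof -
  have "i' \<in> {i. j < row_len l i}" if "i' \<le> i''" "i'' \<in> {i. j < row_len l i}" for i' i''
    using that partition_of_row_len_antimono[OF l, of i' i''] by simp
  then show ?thesis
    unfolding row_len_conjugate[OF l]
    using nat_down_closed_less_card[OF finite_row_len_greater, of j l i] by simp
qed

lemma row_len_eq_nth: "i < length l \<Longrightarrow> row_len l i = l ! i"
  by (simp add: row_len_def)

text \<open>Conjugation transposes the diagram by \<open>less_row_len_conjugate\<close>. In this
  symmetric form self-conjugacy enters all later arguments.\<close>

lemma conjugate_eq_self_iff:
  assumes l: "partition_of n l"
  shows "conjugate l = l \<longleftrightarrow> (\<forall>i j. j < row_len l i \<longleftrightarrow> i < row_len l j)"
proof
  assume "conjugate l = l"
  then show "\<forall>i j. j < row_len l i \<longleftrightarrow> i < row_len l j"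
    using less_row_len_conjugate[OF l] by auto
next
  assume sym: "\<forall>i j. j < row_len l i \<longleftrightarrow> i < row_len l j"
  have "i < row_len (conjugate l) j \<longleftrightarrow> i < row_len l j" for i j
    using less_row_len_conjugate[OF l] sym by auto
  then have p: "row_len (conjugate l) j = row_len l j" for j
    by (intro nat_eqI_less)
  have "length (conjugate l) = row_len l 0"
    by (simp add: conjugate_def row_len_def split: list.split)
  also have "i < row_len l 0 \<longleftrightarrow> i < length l" for i
    using sym partition_of_row_len_pos_iff[OF l] by auto
  then have "row_len l 0 = length l" by (intro nat_eqI_less)
  finally have len: "length (conjugate l) = length l" .
  show "conjugate l = l"
    by (rule nth_equalityI[OF len]) (metis len p row_len_eq_nth)
qed

section \<open>The diagonal and its hooks\<close>

lemma less_diag_rank_iff: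
  assumes l: "partition_of n l"
  shows "i < diag_rank l \<longleftrightarrow> i < row_len l i"
proof -
  have "{i. i < length l \<and> i < l ! i} = {i. i < row_len l i}"
    by (auto simp: row_len_def)
  moreover have "finite {i. i < row_len l i}"
    by (rule finite_subset[of _ "{..<length l}"]) (auto simp: row_len_def split: if_splits)
  ultimately show ?thesis
    unfolding diag_rank_def
    using nat_down_closed_less_card[of "{i. i < row_len l i}" i] partition_of_row_len_antimono[OF l]
    by (metis (mono_tags, lifting) le_less_trans less_le_trans mem_Collect_eq)
qed

lemma diag_hooks_nth:
  assumes l: "partition_of n l" and i: "i < diag_rank l"
  shows "diag_hooks l ! i = 2 * row_len l i - (2 * i + 1)"
proof -
  have "i < length l" using i less_diag_rank_iff[OF l] by (auto simp: row_len_def split: if_splits)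
  then show ?thesis using i by (simp add: diag_hooks_def row_len_def)
qed

lemma length_diag_hooks [simp]: "length (diag_hooks l) = diag_rank l"
  by (simp add: diag_hooks_def)

text \<open>A cell \<open>(i, j)\<close> lies on the diagonal hook number \<open>min i j\<close>.\<close>

lemma sum_list_diag_hooks:
  assumes l: "partition_of n l" and sym: "\<And>i j. j < row_len l i \<longleftrightarrow> i < row_len l j"
  shows "sum_list (diag_hooks l) = n"
proof -
  let ?D = "SIGMA i:{..<length l}. {..<row_len l i}"
  \<comment> \<open>The corner and arm of hook \<open>k\<close>, followed by its leg; by symmetry,
    column \<open>k\<close> also has length \<open>row_len l k\<close>.\<close>
  let ?H = "\<lambda>k. Pair k ` {k..<row_len l k} \<union> (\<lambda>j. (j, k)) ` {k<..<row_len l k}"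
  have "sum_list l = (\<Sum>i<length l. row_len l i)"
    by (simp add: sum_list_sum_nth row_len_def atLeast0LessThan)
  then have "n = card ?D" using l by (simp add: partition_of_def)
  also have "?D = (\<Union>k<diag_rank l. ?H k)"
  proof (rule set_eqI, clarify)
    fix i j
    have "(i, j) \<in> ?D \<longleftrightarrow> j < row_len l i" by (auto simp: row_len_def)
    also have "\<dots> \<longleftrightarrow> (i, j) \<in> (\<Union>k<diag_rank l. ?H k)"
    proof
      assume a: "j < row_len l i"
      show "(i, j) \<in> (\<Union>k<diag_rank l. ?H k)"
      proof (cases "i \<le> j")
        case True
        then show ?thesis using a by (auto simp: less_diag_rank_iff[OF l] intro!: bexI[of _ i])
      next
        case False
        then show ?thesis using a sym[of j i] by (auto simp: less_diag_rank_iff[OF l] intro!: bexI[of _ j])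
      qed
    next
      assume "(i, j) \<in> (\<Union>k<diag_rank l. ?H k)"
      then show "j < row_len l i" using sym by auto
    qed
    finally show "(i, j) \<in> ?D \<longleftrightarrow> (i, j) \<in> (\<Union>k<diag_rank l. ?H k)" .
  qed
  also have "card \<dots> = (\<Sum>k<diag_rank l. card (?H k))"
    by (rule card_UN_disjoint) auto
  also have "\<dots> = (\<Sum>k<diag_rank l. diag_hooks l ! k)"
  proof (rule sum.cong)
    fix k assume "k \<in> {..<diag_rank l}"
    moreover have "card (?H k) = card (Pair k ` {k..<row_len l k}) + card ((\<lambda>j. (j, k)) ` {k<..<row_len l k})"
      by (rule card_Un_disjoint) auto
    moreover have "\<dots> = (row_len l k - k) + (row_len l k - Suc k)"
      by (subst (1 2) card_image) (auto intro: inj_onI)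
    ultimately show "card (?H k) = diag_hooks l ! k"
      using diag_hooks_nth[OF l, of k] less_diag_rank_iff[OF l, of k] by simp
  qed simp
  also have "\<dots> = sum_list (diag_hooks l)"
    by (simp add: sum_list_sum_nth atLeast0LessThan)
  finally show ?thesis by simp
qed

lemma diag_hooks_in_P_strict_odd:
  assumes "l \<in> P_self_conj n"
  shows "diag_hooks l \<in> P_strict_odd n"
proof -
  have l: "partition_of n l" and sym: "\<And>i j. j < row_len l i \<longleftrightarrow> i < row_len l j"
    using assms conjugate_eq_self_iff by (auto simp: P_self_conj_def)
  \<comment> \<open>Here \<open>a\<close> is the common length of arm and leg. Since rows weakly
    decrease, \<open>a + i\<close> does too, so \<open>a\<close> strictly decreases.\<close>
  have nth: "\<exists>a. row_len l i = Suc (a + i) \<and> diag_hooks l ! i = 2 * a + 1" if "i < diag_rank l" for i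
  proof -
    have "i < row_len l i" using that less_diag_rank_iff[OF l] by simp
    then obtain a where "row_len l i = Suc (a + i)" by (metis add.commute less_imp_Suc_add add_Suc_right)
    then show ?thesis using diag_hooks_nth[OF l that] by (intro exI[of _ a]) simp
  qed
  have odd: "odd p" if p: "p \<in> set (diag_hooks l)" for p
  proof -
    obtain i where "i < diag_rank l" "p = diag_hooks l ! i"
      using p by (auto simp: in_set_conv_nth)
    then show ?thesis using nth[of i] by auto
  qed
  have strict: "sorted_wrt (>) (diag_hooks l)"
    unfolding sorted_wrt_iff_nth_less
  proof (intro allI impI)
    fix i j assume ij: "i < j" "j < length (diag_hooks l)"
    obtain a b where "row_len l i = Suc (a + i)" "diag_hooks l ! i = 2 * a + 1"
      "row_len l j = Suc (b + j)" "diag_hooks l ! j = 2 * b + 1"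
      using nth[of i] nth[of j] ij by auto
    then show "diag_hooks l ! i > diag_hooks l ! j"
      using partition_of_row_len_antimono[OF l, of i j] ij(1) by linarith
  qed
  have "sorted_wrt (\<ge>) (diag_hooks l)"
    by (rule sorted_wrt_mono_rel[OF _ strict]) simp
  then show ?thesis
    using odd strict sum_list_diag_hooks[OF l sym] by (auto simp: P_strict_odd_def partition_of_def)
qed

text \<open>The hooks give the lengths of the first \<open>diag_rank l\<close> rows. These contain
  every cell on or above the diagonal, and symmetry supplies the cells below it.\<close>

lemma inj_on_diag_hooks: "inj_on diag_hooks (P_self_conj n)"
proof (rule inj_onI)
  fix l l' assume "l \<in> P_self_conj n" "l' \<in> P_self_conj n" and eq: "diag_hooks l = diag_hooks l'"
  then have l: "partition_of n l" and sym: "\<And>i j. j < row_len l i \<longleftrightarrow> i < row_len l j"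
    and l': "partition_of n l'" and sym': "\<And>i j. j < row_len l' i \<longleftrightarrow> i < row_len l' j"
    using conjugate_eq_self_iff by (auto simp: P_self_conj_def)
  have r: "diag_rank l = diag_rank l'" by (metis eq length_diag_hooks)
  have row: "row_len l i = row_len l' i" if "i < diag_rank l" for i
    using that diag_hooks_nth[OF l, of i] diag_hooks_nth[OF l', of i] r eq
      less_diag_rank_iff[OF l, of i] less_diag_rank_iff[OF l', of i] by simp
  have upper: "j < row_len l i \<longleftrightarrow> j < row_len l' i" if "i \<le> j" for i j
  proof (cases "i < diag_rank l")
    case False
    then show ?thesis
      using that r less_diag_rank_iff[OF l, of i] less_diag_rank_iff[OF l', of i] by linarith
  qed (simp add: row)
  show "l = l'"
  proof (rule row_len_eqI[OF l l'])
    show "j < row_len l i \<longleftrightarrow> j < row_len l' i" for i j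
      using upper[of i j] upper[of j i] sym[of j i] sym'[of j i] by linarith
  qed
qed

text \<open>Each part \<open>2 * a i + 1\<close> is bent into a symmetric hook with corner
  \<open>(i, i)\<close> and arm \<open>a i\<close>, and the hooks are nested.\<close>

lemma P_strict_odd_subset_diag_hooks: "P_strict_odd n \<subseteq> diag_hooks ` P_self_conj n"
proof
  fix \<mu> assume mu: "\<mu> \<in> P_strict_odd n"
  define r where "r = length \<mu>"
  define a where "a i = \<mu> ! i div 2" for i
  have mu_nth: "\<mu> ! i = 2 * a i + 1" if "i < r" for i
    using mu that by (auto simp: P_strict_odd_def a_def r_def)
  have a_less: "a j < a i" if "i < j" "j < r" for i j
    using mu that mu_nth[of i] mu_nth[of j]
    by (fastforce simp: P_strict_odd_def sorted_wrt_iff_nth_less r_def)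
  have a_anti: "a j + j \<le> a i + i" if "i \<le> j" "j < r" for i j
    using that
  proof (induction j rule: dec_induct)
    case (step k)
    then show ?case using a_less[of k "Suc k"] by simp
  qed simp
  \<comment> \<open>The first \<open>r\<close> rows contain the whole \<open>r\<close> by
    \<open>r\<close> square, which gives the symmetry of \<open>p\<close> when both indices are
    below \<open>r\<close>.\<close>
  have a_large: "r \<le> Suc (a i + i)" if "i < r" for i
    using a_anti[of i "r - 1"] that by linarith
  \<comment> \<open>For \<open>i \<ge> r\<close>, row \<open>i\<close> consists of the columns
    \<open>j < r\<close> whose hook, with leg of length \<open>a j\<close>, reaches down to row
    \<open>i\<close>.\<close>
  define leg where "leg i = card {j. j < r \<and> i \<le> a j + j}" for i
  have leg: "j < leg i \<longleftrightarrow> j < r \<and> i \<le> a j + j" for i j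
    unfolding leg_def
    by (subst nat_down_closed_less_card) (auto dest: a_anti intro: order_trans)
  define p where "p i = (if i < r then Suc (a i + i) else leg i)" for i
  have less_p: "j < p i \<longleftrightarrow> (if i < r then j \<le> a i + i else j < r \<and> i \<le> a j + j)" for i j
    by (simp add: p_def leg less_Suc_eq_le)
  have sym: "j < p i \<longleftrightarrow> i < p j" for i j
    using a_large[of i] a_large[of j] unfolding less_p by auto
  have p_anti: "p j \<le> p i" if "i \<le> j" for i j
  proof -
    have "k < p i" if "k < p j" for k
    proof -
      have "j < p k" using that sym by simp
      with \<open>i \<le> j\<close> have "i < p k" by simp
      then show ?thesis using sym by simp
    qed
    then show ?thesis by (metis leI less_irrefl)
  qed
  \<comment> \<open>By symmetry the length \<open>p 0\<close> of the first row is also the number of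
    nonzero rows.\<close>
  define l where "l = map p [0..<p 0]"
  have part: "row_len l i = p i" for i
    using sym[of i 0] by (auto simp: row_len_def l_def)
  have "sorted_wrt (\<ge>) l"
    using p_anti by (auto simp: l_def sorted_wrt_iff_nth_less)
  moreover have "0 \<notin> set l"
  proof
    assume "0 \<in> set l"
    then obtain i where "i < p 0" "p i = 0" by (auto simp: l_def)
    then show False using sym[of 0 i] by simp
  qed
  \<comment> \<open>The size is left open here; it is identified with \<open>n\<close> once the
    hooks are known to be \<open>\<mu>\<close>.\<close>
  ultimately have l: "partition_of (sum_list l) l" by (simp add: partition_of_def)
  have lsym: "j < row_len l i \<longleftrightarrow> i < row_len l j" for i j unfolding part by (rule sym)
  have r: "diag_rank l = r"
  proof -
    have "i < diag_rank l \<longleftrightarrow> i < r" for i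
      unfolding less_diag_rank_iff[OF l] part less_p by auto
    then show ?thesis by (intro nat_eqI_less)
  qed
  have hooks: "diag_hooks l = \<mu>"
  proof (rule nth_equalityI)
    show "diag_hooks l ! i = \<mu> ! i" if "i < length (diag_hooks l)" for i
      using that diag_hooks_nth[OF l, of i] mu_nth[of i] by (simp add: r part p_def)
  qed (simp add: r r_def)
  have "sum_list l = n"
    using sum_list_diag_hooks[OF l lsym] mu hooks by (simp add: P_strict_odd_def partition_of_def)
  then have "l \<in> P_self_conj n"
    using l lsym conjugate_eq_self_iff[OF l] by (simp add: P_self_conj_def)
  then show "\<mu> \<in> diag_hooks ` P_self_conj n" using hooks by blast
qed

lemma bij_betw_diag_hooks: "bij_betw diag_hooks (P_self_conj n) (P_strict_odd n)"
  unfolding bij_betw_def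
  using inj_on_diag_hooks diag_hooks_in_P_strict_odd P_strict_odd_subset_diag_hooks by blast

section \<open>Immanants as products of traces\<close>

lemma prod_list_concat: "prod_list (concat xss) = prod_list (map prod_list xss)"
  by (induction xss) simp_all

text \<open>The sign of passing from row order to cycle order does not depend on \<open>I\<close>.
  After the reordering each cycle is a closed walk, and summation over \<open>I\<close> turns it
  into a trace.\<close>

lemma sum_perm_prod:
  fixes A :: "'a::complex_algebra_1^'k^'k"
  assumes A: "anticommuting (entries A)" and s: "\<sigma> permutes {..<n}"
  shows "(\<Sum>I \<in> {..<n} \<rightarrow>\<^sub>E UNIV. perm_prod n (subm A I) \<sigma>)
       = of_int (cycle_sign n \<sigma>) * prod_list (map (\<lambda>k. trace (matpow A k)) (cycle_type n \<sigma>))"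
proof -
  let ?cs = "some_cycles n \<sigma>"
  have not: "cycle_notation n \<sigma> ?cs" by (rule some_cycles[OF s])
  then have cs: "distinct (concat ?cs)" "[] \<notin> set ?cs" "set (concat ?cs) = {..<n}"
    by (simp_all add: cycle_notation_iff)
  then have sort: "sort (concat ?cs) = [0..<n]"
    by (intro sorted_distinct_set_unique) (auto simp: atLeast0LessThan)
  have "perm_prod n (subm A I) \<sigma>
      = of_int (cycle_sign n \<sigma>) * prod_list (map (\<lambda>c. closed_walk A (map I c)) ?cs)" for I
  proof -
    let ?g = "\<lambda>s. A $ I s $ I (\<sigma> s)"
    have "perm_prod n (subm A I) \<sigma> = prod_list (map ?g (sort (concat ?cs)))"
      by (simp add: perm_prod_def subm_def sort)
    also have "\<dots> = (- 1) ^ inversion_count (concat ?cs) * prod_list (map ?g (concat ?cs))"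
      by (rule prod_list_sort_anticommute, rule anticommuting_entries[OF A])
    also have "(- 1) ^ inversion_count (concat ?cs) = (of_int (cycle_sign n \<sigma>) :: 'a)"
      by (simp add: cycle_sign_def some_cycles_def)
    also have "prod_list (map ?g (concat ?cs)) = prod_list (map (\<lambda>c. prod_list (map ?g c)) ?cs)"
      by (simp add: map_concat prod_list_concat comp_def)
    also have "map (\<lambda>c. prod_list (map ?g c)) ?cs = map (\<lambda>c. closed_walk A (map I c)) ?cs"
      using cs(2) by (intro map_cong refl prod_list_eq_closed_walk cycle_notation_map[OF not]) auto
    finally show ?thesis .
  qed
  then show ?thesis
    using sum_prod_closed_walks[OF cs(1,2), of A, unfolded cs(3)]
    by (simp add: cycle_type_def comp_def flip: sum_distrib_left)
qed

lemma cycle_sign_square: "cycle_sign n \<sigma> * cycle_sign n \<sigma> = 1"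
  by (simp add: cycle_sign_def flip: power_mult_distrib)

lemma of_int_cycle_sign_mult:
  "of_int (cycle_sign n \<sigma>) * x = of_int (cycle_sign n \<sigma>) *\<^sub>C (x :: 'a::complex_algebra_1)"
  by (simp add: cycle_sign_def minus_one_power_mult_eq_scaleC)

text \<open>Grouping by cycle type uses the class sizes from \<open>card_cycle_type\<close>. It is
  kept general in \<open>f\<close> to serve both the permanent and the immanants.\<close>

lemma sum_cycle_type:
  fixes f :: "nat list \<Rightarrow> 'a::complex_algebra_1"
  assumes "\<And>\<mu>. partition_of n \<mu> \<Longrightarrow> \<mu> \<notin> P_strict_odd n \<Longrightarrow> f \<mu> = 0"
  shows "(1 / fact n) *\<^sub>C (\<Sum>\<sigma> | \<sigma> permutes {..<n}. f (cycle_type n \<sigma>))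
       = (\<Sum>\<mu>\<in>P_strict_odd n. (1 / of_nat (prod_list \<mu>)) *\<^sub>C f \<mu>)"
proof -
  let ?S = "\<lambda>\<mu>. {\<sigma>. \<sigma> permutes {..<n} \<and> cycle_type n \<sigma> = \<mu>}"
  have "(\<Sum>\<sigma> | \<sigma> permutes {..<n}. f (cycle_type n \<sigma>))
      = (\<Sum>\<mu> | partition_of n \<mu>. \<Sum>\<sigma>\<in>?S \<mu>. f (cycle_type n \<sigma>))"
  proof -
    have "cycle_type n ` {\<sigma>. \<sigma> permutes {..<n}} \<subseteq> {\<mu>. partition_of n \<mu>}"
      using partition_of_cycle_type by blast
    from sum.group[OF finite_permutations finite_partitions this, of "\<lambda>\<sigma>. f (cycle_type n \<sigma>)"]
    show ?thesis by simp
  qed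
  also have "\<dots> = (\<Sum>\<mu> | partition_of n \<mu>. of_nat (card (?S \<mu>)) *\<^sub>C f \<mu>)"
    by (intro sum.cong refl) (simp flip: scaleC_const_sum)
  also have "\<dots> = (\<Sum>\<mu>\<in>P_strict_odd n. of_nat (card (?S \<mu>)) *\<^sub>C f \<mu>)"
    by (intro sum.mono_neutral_right finite_partitions)
       (auto simp: assms P_strict_odd_def)
  finally have "(1 / fact n) *\<^sub>C (\<Sum>\<sigma> | \<sigma> permutes {..<n}. f (cycle_type n \<sigma>))
      = (\<Sum>\<mu>\<in>P_strict_odd n. (1 / fact n * of_nat (card (?S \<mu>))) *\<^sub>C f \<mu>)"
    by (simp add: scaleC_sum_right scaleC_scaleC)
  also have "\<dots> = (\<Sum>\<mu>\<in>P_strict_odd n. (1 / of_nat (prod_list \<mu>)) *\<^sub>C f \<mu>)"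
  proof (intro sum.cong refl)
    fix \<mu> assume mu: "\<mu> \<in> P_strict_odd n"
    have "of_nat (card (?S \<mu>)) * of_nat (prod_list \<mu>) = (fact n :: complex)"
      using card_cycle_type[OF mu] by (metis of_nat_fact of_nat_mult)
    moreover from this have "of_nat (prod_list \<mu>) \<noteq> (0 :: complex)"
      by (metis fact_nonzero mult_zero_right)
    ultimately have "1 / fact n * of_nat (card (?S \<mu>)) = (1 / of_nat (prod_list \<mu>) :: complex)"
      by (simp add: divide_simps)
    then show "(1 / fact n * of_nat (card (?S \<mu>))) *\<^sub>C f \<mu> = (1 / of_nat (prod_list \<mu>)) *\<^sub>C f \<mu>"
      by simp
  qed
  finally show ?thesis .
qed

text \<open>The sign in \<open>chi_star\<close> and the reordering sign from
  \<open>sum_perm_prod\<close> are equal and multiply to 1, so all permutations of type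
  \<open>\<mu>\<close> contribute the same term.\<close>

lemma imm_star_n_eq:
  fixes A :: "'a::complex_algebra_1^'k^'k"
  assumes A: "anticommuting (entries A)" and l: "l \<in> P_self_conj n"
  defines "\<mu> \<equiv> diag_hooks l"
  shows "imm_star_n n l A = (\<i> ^ m_half l * of_real (sqrt (real (prod_list \<mu>))) / of_nat (prod_list \<mu>)) *\<^sub>C
    prod_list (map (\<lambda>k. trace (matpow A k)) \<mu>)"
proof -
  let ?\<tau> = "prod_list (map (\<lambda>k. trace (matpow A k)) \<mu>)"
  let ?c = "\<i> ^ m_half l * of_real (sqrt (real (prod_list \<mu>)))"
  have mu: "\<mu> \<in> P_strict_odd n" unfolding \<mu>_def by (rule diag_hooks_in_P_strict_odd[OF l])
  have "chi_star n l \<sigma> *\<^sub>C (\<Sum>I \<in> {..<n} \<rightarrow>\<^sub>E UNIV. perm_prod n (subm A I) \<sigma>)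
      = (if cycle_type n \<sigma> = \<mu> then ?c *\<^sub>C ?\<tau> else 0)" if s: "\<sigma> permutes {..<n}" for \<sigma>
  proof (cases "cycle_type n \<sigma> = \<mu>")
    case True
    have "complex_of_int (cycle_sign n \<sigma>) * of_int (cycle_sign n \<sigma>) = 1"
      by (metis cycle_sign_square of_int_1 of_int_mult)
    then have "chi_star n l \<sigma> * of_int (cycle_sign n \<sigma>) = ?c"
      using True by (simp add: chi_star_def has_cycle_type_iff[OF s] \<mu>_def mult_ac)
    then show ?thesis
      using True by (simp add: sum_perm_prod[OF A s] of_int_cycle_sign_mult scaleC_scaleC)
  qed (simp add: chi_star_def has_cycle_type_iff[OF s] \<mu>_def)
  then have "imm_star_n n l A = (1 / fact n) *\<^sub>C
      (\<Sum>\<sigma> | \<sigma> permutes {..<n}. if cycle_type n \<sigma> = \<mu> then ?c *\<^sub>C ?\<tau> else 0)"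
    unfolding imm_star_n_def imm_star_def
    by (subst sum.swap) (simp add: scaleC_sum_right[symmetric])
  also have "\<dots> = (\<Sum>\<nu>\<in>P_strict_odd n. (1 / of_nat (prod_list \<nu>)) *\<^sub>C (if \<nu> = \<mu> then ?c *\<^sub>C ?\<tau> else 0))"
    using mu by (intro sum_cycle_type) auto
  also have "\<dots> = (1 / of_nat (prod_list \<mu>)) *\<^sub>C ?c *\<^sub>C ?\<tau>"
    using mu by (simp add: if_distrib[of "(*\<^sub>C) _"] finite_P_strict_odd cong: if_cong)
  finally show ?thesis by (simp add: scaleC_scaleC)
qed

section \<open>Kronecker products\<close>

text \<open>Extensional functions are \<open>undefined\<close> off \<open>S\<close>, and taking
  components need not preserve this. Hence the bijection restricts to \<open>S\<close>, and
  \<open>f\<close> is required to see only values on \<open>S\<close>.\<close>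

lemma sum_PiE_pair:
  "(\<Sum>I \<in> S \<rightarrow>\<^sub>E UNIV. f (\<lambda>s. fst (I s)) (\<lambda>s. snd (I s)))
 = (\<Sum>I \<in> S \<rightarrow>\<^sub>E UNIV. \<Sum>J \<in> S \<rightarrow>\<^sub>E UNIV. f I J)"
  if "\<And>I I' J J'. (\<And>s. s \<in> S \<Longrightarrow> I s = I' s) \<Longrightarrow> (\<And>s. s \<in> S \<Longrightarrow> J s = J' s) \<Longrightarrow> f I J = f I' J'"
  unfolding sum.cartesian_product
  by (rule sum.reindex_bij_witness[of _ "\<lambda>(I, J). \<lambda>s\<in>S. (I s, J s)"
        "\<lambda>I. (\<lambda>s\<in>S. fst (I s), \<lambda>s\<in>S. snd (I s))"])
     (auto simp: fun_eq_iff PiE_def extensional_def intro!: that)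

lemma sum_perm_prod_kronecker:
  fixes A :: "'a::complex_algebra_1^'m^'m" and B :: "'a^'n^'n"
  assumes comm: "\<forall>x \<in> entries A. \<forall>y \<in> entries B. x * y = y * x"
    and s: "\<sigma> permutes {..<n}"
  shows "(\<Sum>I \<in> {..<n} \<rightarrow>\<^sub>E UNIV. perm_prod n (subm (kronecker A B) I) \<sigma>)
       = (\<Sum>I \<in> {..<n} \<rightarrow>\<^sub>E UNIV. perm_prod n (subm A I) \<sigma>) *
         (\<Sum>J \<in> {..<n} \<rightarrow>\<^sub>E UNIV. perm_prod n (subm B J) \<sigma>)"
proof -
  have AB: "A $ a $ b * B $ c $ d = B $ c $ d * A $ a $ b" for a b c d
    using comm unfolding entries_def by blast
  have kron: "perm_prod n (subm (kronecker A B) I) \<sigma>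
      = perm_prod n (subm A (\<lambda>s. fst (I s))) \<sigma> * perm_prod n (subm B (\<lambda>s. snd (I s))) \<sigma>" for I
    by (simp add: perm_prod_def subm_def kronecker_def prod_list_map_mult_commute[OF AB])
  have dep: "perm_prod n (subm M I) \<sigma> = perm_prod n (subm M I') \<sigma>"
    if "\<And>s. s \<in> {..<n} \<Longrightarrow> I s = I' s" for M :: "'a^'k^'k" and I I'
    unfolding perm_prod_def subm_def
    by (intro arg_cong[where f = prod_list] map_cong refl)
       (use that permutes_in_image[OF s] in auto)
  have "(\<Sum>I \<in> {..<n} \<rightarrow>\<^sub>E UNIV. perm_prod n (subm A (\<lambda>s. fst (I s))) \<sigma> * perm_prod n (subm B (\<lambda>s. snd (I s))) \<sigma>)
      = (\<Sum>I \<in> {..<n} \<rightarrow>\<^sub>E UNIV. \<Sum>J \<in> {..<n} \<rightarrow>\<^sub>E UNIV. perm_prod n (subm A I) \<sigma> * perm_prod n (subm B J) \<sigma>)"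
    by (rule sum_PiE_pair[of "{..<n}" "\<lambda>I J. perm_prod n (subm A I) \<sigma> * perm_prod n (subm B J) \<sigma>"])
       (rule arg_cong2[where f = "(*)", OF dep dep])
  then show ?thesis by (simp only: kron sum_product)
qed

theorem theorem1p4:
  fixes A :: "'a::complex_algebra_1^'m^'m" and B :: "'a^'n^'n" and n :: nat
  assumes "anticommuting (entries A)"
    and "anticommuting (entries B)"
    and "\<forall>x \<in> entries A. \<forall>y \<in> entries B. x * y = y * x"
  shows "det_n n (kronecker A B) = per_n n (kronecker A B) \<and>
    per_n n (kronecker A B) =
      (\<Sum>l \<in> P_self_conj n. (-1) ^ m_half l * imm_star_n n l A * imm_star_n n l B) \<and>
    (\<Sum>l \<in> P_self_conj n. (-1) ^ m_half l * imm_star_n n l A * imm_star_n n l B) =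
      (\<Sum>\<mu> \<in> P_strict_odd n. (1 / of_nat (prod_list \<mu>)) *\<^sub>C
         (prod_list (map (\<lambda>k. trace (matpow A k)) \<mu>) * prod_list (map (\<lambda>k. trace (matpow B k)) \<mu>)))"
proof -
  let ?\<alpha> = "\<lambda>\<mu>. prod_list (map (\<lambda>k. trace (matpow A k)) \<mu>)"
  let ?\<beta> = "\<lambda>\<mu>. prod_list (map (\<lambda>k. trace (matpow B k)) \<mu>)"
  let ?T = "\<lambda>\<sigma>. \<Sum>I \<in> {..<n} \<rightarrow>\<^sub>E UNIV. perm_prod n (subm (kronecker A B) I) \<sigma>"
  have vanish: "?\<alpha> \<mu> = 0" if "partition_of n \<mu>" "\<mu> \<notin> P_strict_odd n" for \<mu>
    using prod_list_trace_matpow_eq_0[OF assms(1) that] .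
  \<comment> \<open>\<open>A\<close> and \<open>B\<close> are reordered along the same cycles, so
    the same sign appears twice and cancels.\<close>
  have T: "?T \<sigma> = ?\<alpha> (cycle_type n \<sigma>) * ?\<beta> (cycle_type n \<sigma>)" if s: "\<sigma> permutes {..<n}" for \<sigma>
  proof -
    have "complex_of_int (cycle_sign n \<sigma>) * of_int (cycle_sign n \<sigma>) = 1"
      by (metis cycle_sign_square of_int_1 of_int_mult)
    then show ?thesis
      unfolding sum_perm_prod_kronecker[OF assms(3) s] sum_perm_prod[OF assms(1) s]
        sum_perm_prod[OF assms(2) s] of_int_cycle_sign_mult
      by (simp add: mult_scaleC_left mult_scaleC_right scaleC_scaleC scaleC_one)
  qed
  have sgn: "of_int (sign \<sigma>) * ?T \<sigma> = ?T \<sigma>" if s: "\<sigma> permutes {..<n}" for \<sigma>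
  proof (cases "cycle_type n \<sigma> \<in> P_strict_odd n")
    case True
    then show ?thesis by (simp add: sign_eq_1_of_cycle_type[OF s])
  next
    case False
    then have "?T \<sigma> = 0"
      unfolding T[OF s] vanish[OF partition_of_cycle_type[OF s] False] by simp
    then show ?thesis by simp
  qed
  have "det_n n (kronecker A B)
      = (1 / fact n) *\<^sub>C (\<Sum>\<sigma> | \<sigma> permutes {..<n}. of_int (sign \<sigma>) * ?T \<sigma>)"
    unfolding det_n_def det_fun_def by (subst sum.swap) (simp add: sum_distrib_left)
  also have "\<dots> = (1 / fact n) *\<^sub>C (\<Sum>\<sigma> | \<sigma> permutes {..<n}. ?T \<sigma>)"
    using sgn by simp
  also have per: "\<dots> = per_n n (kronecker A B)"
    unfolding per_n_def per_fun_def by (subst sum.swap) simp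
  finally have det: "det_n n (kronecker A B) = per_n n (kronecker A B)" .
  have "per_n n (kronecker A B)
      = (1 / fact n) *\<^sub>C (\<Sum>\<sigma> | \<sigma> permutes {..<n}. ?\<alpha> (cycle_type n \<sigma>) * ?\<beta> (cycle_type n \<sigma>))"
    unfolding per[symmetric] using T by simp
  also have "\<dots> = (\<Sum>\<mu> \<in> P_strict_odd n. (1 / of_nat (prod_list \<mu>)) *\<^sub>C (?\<alpha> \<mu> * ?\<beta> \<mu>))"
    by (rule sum_cycle_type) (simp add: vanish)
  finally have per_traces: "per_n n (kronecker A B)
      = (\<Sum>\<mu> \<in> P_strict_odd n. (1 / of_nat (prod_list \<mu>)) *\<^sub>C (?\<alpha> \<mu> * ?\<beta> \<mu>))" .
  have "(-1) ^ m_half l * imm_star_n n l A * imm_star_n n l B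
      = (1 / of_nat (prod_list (diag_hooks l))) *\<^sub>C (?\<alpha> (diag_hooks l) * ?\<beta> (diag_hooks l))"
    if l: "l \<in> P_self_conj n" for l
  proof -
    let ?P = "prod_list (diag_hooks l)"
    let ?c = "\<i> ^ m_half l * of_real (sqrt (real ?P)) / of_nat ?P"
    have "?P \<noteq> 0"
      using diag_hooks_in_P_strict_odd[OF l]
      by (simp add: prod_list_zero_iff P_strict_odd_def partition_of_def)
    moreover have "complex_of_real (sqrt (real ?P)) * of_real (sqrt (real ?P)) = of_nat ?P"
      by (simp flip: of_real_mult)
    moreover have "(- 1) ^ m_half l * (\<i> ^ m_half l * \<i> ^ m_half l) = 1"
      by (simp flip: power_mult_distrib)
    \<comment> \<open>The sign cancels the square of \<open>\<i> ^ m_half l\<close>, and the squared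
      root cancels one of the two factors \<open>?P\<close> in the denominator.\<close>
    ultimately have "(- 1) ^ m_half l * (?c * ?c) = 1 / of_nat ?P"
      by (simp add: field_simps)
    moreover have "(-1) ^ m_half l * (c *\<^sub>C x) * (c *\<^sub>C y) = ((- 1) ^ m_half l * (c * c)) *\<^sub>C (x * y)"
      for c and x y :: 'a
      by (simp add: minus_one_power_mult_eq_scaleC mult_scaleC_left mult_scaleC_right scaleC_scaleC
          mult_ac)
    ultimately show ?thesis
      by (simp only: imm_star_n_eq[OF assms(1) l] imm_star_n_eq[OF assms(2) l])
  qed
  then have "(\<Sum>l \<in> P_self_conj n. (-1) ^ m_half l * imm_star_n n l A * imm_star_n n l B)
      = (\<Sum>\<mu> \<in> P_strict_odd n. (1 / of_nat (prod_list \<mu>)) *\<^sub>C (?\<alpha> \<mu> * ?\<beta> \<mu>))"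
    by (simp add: sum.reindex_bij_betw[OF bij_betw_diag_hooks, symmetric])
  then show ?thesis using det per_traces by simp
qed

end
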